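(* Let $n$ be a positive even integer and let \[ A_n=\{\Delta_K(t)\;:\;K \text{ is a modular knot and } \deg \Delta_K = n\}\subset \mathbb{Z}[t]. \] Then $\# A_n \le p(n)$, where $p(n)$ is the number of partitions of $n$. In particular, $A_n$ is a finite set.
   Context: Words: let $\{L,R\}^*_{\mathrm{prim}}$ be the set of finite nonempty words over the alphabet $\{L,R\}$ that are primitive (not of the form $U^k$ for a shorter word $U$ and $k\ge 2$). Let $\mathrm{cyc}$ move the first letter of a word to the end. For $W\in\{L,R\}^*_{\mathrm{prim}}$ of length $m\ge 2$, its $m$ cyclic permutations are distinct; for $1\le j\le m$ let $\mathrm{rank}_j(W)\in\{1,\dots,m\}$ be the rank of $\mathrm{cyc}^{j-1}(W)$ among all cyclic permutations of $W$ in ascending lexicographic order with $L<R$, and put $\mathrm{rank}_{m+1}(W)=\mathrm{rank}_1(W)$. The modular braid $\mathbb{M}(W)$ is the $m$-strand braid obtained by placing $m$ points on a top line and $m$ points on a bottom line and joining, for each $1\le j\le m$, the $\mathrm{rank}_j(W)$-th top point to the $\mathrm{rank}_{j+1}(W)$-th bottom point by a straight segment, where at each crossing the strand starting at a top point whose cyclic permutation begins with $L$ passes over the strand starting at a top point whose cyclic permutation begins with $R$ (this is a positive braid). A modular knot is the closure of $\mathbb{M}(W)$ for some $W\in\{L,R\}^*_{\mathrm{prim}}$ of length at least $2$ (such closures are knots). Equivalently, modular knots are the closed orbits of the geodesic flow on $\mathrm{SL}_2(\mathbb{Z})\backslash\mathrm{SL}_2(\mathbb{R})$, i.e. the knots attached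 to classes of indefinite integral binary quadratic forms of positive non-square discriminant. For a knot $K$, $\Delta_K(t)$ denotes its Alexander polynomial, normalized (by multiplication by a unit $\pm t^k$ of $\mathbb{Z}[t,t^{-1}]$) to be a polynomial in $\mathbb{Z}[t]$ with nonzero constant term and $\Delta_K(1)=1$. *)

theory Defs
  imports "HOL-Computational_Algebra.Polynomial" "HOL-Library.Multiset"
          "Jordan_Normal_Form.Determinant"
begin

datatype letter = L | R

definition primitive_word :: "letter list \<Rightarrow> bool" where
  "primitive_word w \<longleftrightarrow> w \<noteq> [] \<and>
     \<not> (\<exists>u k. k \<ge> 2 \<and> w = concat (replicate k u))"

definition lex_less :: "letter list \<Rightarrow> letter list \<Rightarrow> bool" where
  "lex_less u v \<longleftrightarrow> (u, v) \<in> lexord {(L, R)}"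

text \<open>0-based rank of the cyclic permutation rotate k W among all cyclic permutations
  (rank_(k+1)(W) of the paper minus one).\<close>
definition rk :: "letter list \<Rightarrow> nat \<Rightarrow> nat" where
  "rk W k = card {i. i < length W \<and> lex_less (rotate i W) (rotate k W)}"

text \<open>The permutation of the modular braid: the strand starting at top point
  rk W k (0-based) ends at bottom point rk W ((k+1) mod m).  Listed by top point.\<close>
definition modular_perm :: "letter list \<Rightarrow> nat list" where
  "modular_perm W = map (\<lambda>a. rk W (Suc (THE k. k < length W \<and> rk W k = a) mod length W))
                        [0..<length W]"

definition has_inv :: "nat list \<Rightarrow> bool" where
  "has_inv p \<longleftrightarrow> (\<exists>i. Suc i < length p \<and> p ! i > p ! Suc i)"

definition first_inv :: "nat list \<Rightarrow> nat" where
  "first_inv p = (LEAST i. Suc i < length p \<and> p ! i > p ! Suc i)"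

definition swap_adj :: "nat list \<Rightarrow> nat \<Rightarrow> nat list" where
  "swap_adj p i = p[i := p ! Suc i, Suc i := p ! i]"

text \<open>Bubble sort, read from top to bottom: each adjacent swap of an inverted pair
  is one crossing sigma_i (0-based i) of the two straight strands.\<close>
fun bubble_word :: "nat \<Rightarrow> nat list \<Rightarrow> nat list" where
  "bubble_word 0 p = []"
| "bubble_word (Suc f) p =
     (if has_inv p then first_inv p # bubble_word f (swap_adj p (first_inv p)) else [])"

definition modular_braid_word :: "letter list \<Rightarrow> nat list" where
  "modular_braid_word W =
     bubble_word (length W * length W) (modular_perm W)"

definition burau_gen :: "nat \<Rightarrow> nat \<Rightarrow> int poly mat" where
  "burau_gen m i = mat m m (\<lambda>(r, c).
      if r = i \<and> c = i then [:1, -1:]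
      else if r = i \<and> c = Suc i then [:0, 1:]
      else if r = Suc i \<and> c = i then 1
      else if r = Suc i \<and> c = Suc i then 0
      else if r = c then 1 else 0)"

definition burau :: "nat \<Rightarrow> nat list \<Rightarrow> int poly mat" where
  "burau m w = foldl (\<lambda>A i. A * burau_gen m i) (1\<^sub>m m) w"

text \<open>Fox-calculus Alexander matrix of the closed braid: I - Burau(beta); deleting
  one row and one column gives the Alexander polynomial up to a unit +-t^k.\<close>
definition alexander_raw :: "nat \<Rightarrow> nat list \<Rightarrow> int poly" where
  "alexander_raw m w = det (mat_delete (1\<^sub>m m - burau m w) 0 0)"

definition alex_normalize :: "int poly \<Rightarrow> int poly" where
  "alex_normalize f = (THE p. poly p 0 \<noteq> 0 \<and> poly p 1 = 1 \<and>
      (\<exists>k::nat. \<exists>u::int. (u = 1 \<or> u = -1) \<and> smult u f = monom 1 k * p))"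

definition modular_alexander :: "letter list \<Rightarrow> int poly" where
  "modular_alexander W = alex_normalize (alexander_raw (length W) (modular_braid_word W))"

definition is_modular_word :: "letter list \<Rightarrow> bool" where
  "is_modular_word W \<longleftrightarrow> primitive_word W \<and> length W \<ge> 2"

definition A_set :: "nat \<Rightarrow> int poly set" where
  "A_set n = {modular_alexander W | W. is_modular_word W \<and> degree (modular_alexander W) = n}"

definition partition_count :: "nat \<Rightarrow> nat" where
  "partition_count n = card {M :: nat multiset. (\<forall>x \<in># M. x > 0) \<and> sum_mset M = n}"

end

(* In the braid of a modular word the p strands beginning with L cross over the q others. Let
   d_1 <= ... <= d_p be the displacements of the over strands; all are positive and d_p = q because
   the closure is a knot. The Burau matrix B can be written down explicitly in terms of the d_i, and
   the cofactor of I - B is 1 at t = 0 and at t = 1, so it is already normalized, while its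
   degree is the sum of the d_i - 1 for i < p. Deleting an over strand with d_1 = 1, or lowering d_p
   as long as it stays >= d_(p-1), does not change the cofactor (destabilisation). Hence the
   Alexander polynomial depends only on the positive numbers among the d_i - 1 for i < p, and
   these form a partition of its degree. *)

theory Submission
  imports Defs
begin

section \<open>Determinants\<close>

text \<open>An explicit Burau matrix \<open>B\<close> still leaves a determinant with many Leibniz
  terms; two devices cut them down. First, \<open>I - B\<close> is annihilated by the all-ones
  vector on the right and by the powers of \<open>t\<close> on the left, so every cofactor is a
  power of \<open>t\<close> times the one at \<open>(0, 0)\<close>, and each computation may delete
  the row and column that suit it. Second, for a good choice the nonzero entries that matter form a
  graph without cycles, witnessed by an integer potential that grows along its edges, so that a
  single permutation survives. This settles the values at \<open>t = 0\<close> and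
  \<open>t = 1\<close> and the top coefficient, each with its own potential. The closed form of
  \<open>B\<close> has to be established for a word produced by bubble sort, whose intermediate
  lists are no longer Lorenz permutations; hence it is proved for a wider class of partially sorted
  lists. The knot property is used twice: absence of fixed points gives positive displacements and
  makes the last over strand cross everything, and the single cycle gives the value 1 at
  \<open>t = 1\<close>.\<close>

definition replace_row :: "'a :: comm_ring_1 mat \<Rightarrow> nat \<Rightarrow> nat \<Rightarrow> 'a mat" where
  "replace_row A r c = mat (dim_row A) (dim_col A)
     (\<lambda>(i, j). if i = r then (if j = c then 1 else 0) else A $$ (i, j))"

text \<open>The cofactors along row \<open>r\<close> do not see row \<open>r\<close>, so replacing
  that row leaves them unchanged.\<close>

lemma det_row_linear:
  fixes A :: "'a :: comm_ring_1 mat"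
  assumes A: "A \<in> carrier_mat n n" and r: "r < n"
  shows "det (mat n n (\<lambda>(i, j). if i = r then v j else A $$ (i, j))) = (\<Sum>j<n. v j * cofactor A r j)"
proof -
  let ?B = "mat n n (\<lambda>(i, j). if i = r then v j else A $$ (i, j))"
  have "det ?B = (\<Sum>j<n. ?B $$ (r, j) * cofactor ?B r j)"
    by (rule laplace_expansion_row[OF _ r]) simp
  also have "\<dots> = (\<Sum>j<n. v j * cofactor A r j)"
  proof (rule sum.cong, goal_cases)
    case (2 j)
    have "mat_delete ?B r j = mat_delete A r j"
      using A r 2 by (intro eq_matI) (auto simp: mat_delete_def)
    then show ?case using r 2 by (simp add: cofactor_def)
  qed simp
  finally show ?thesis .
qed

lemma det_col_linear:
  fixes A :: "'a :: comm_ring_1 mat"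
  assumes A: "A \<in> carrier_mat n n" and c: "c < n"
  shows "det (mat n n (\<lambda>(i, j). if j = c then v i else A $$ (i, j))) = (\<Sum>i<n. v i * cofactor A i c)"
proof -
  let ?B = "mat n n (\<lambda>(i, j). if j = c then v i else A $$ (i, j))"
  have "det ?B = (\<Sum>i<n. ?B $$ (i, c) * cofactor ?B i c)"
    by (rule laplace_expansion_column[OF _ c]) simp
  also have "\<dots> = (\<Sum>i<n. v i * cofactor A i c)"
  proof (rule sum.cong, goal_cases)
    case (2 j)
    have "mat_delete ?B j c = mat_delete A j c"
      using A c 2 by (intro eq_matI) (auto simp: mat_delete_def)
    then show ?case using c 2 by (simp add: cofactor_def)
  qed simp
  finally show ?thesis .
qed

text \<open>Writing a cofactor as a determinant of full size keeps the index set of the strands, so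
  potentials can be stated without reindexing around a deleted row and column.\<close>

lemma det_replace_row:
  fixes A :: "'a :: comm_ring_1 mat"
  assumes A: "A \<in> carrier_mat n n" and r: "r < n" and c: "c < n"
  shows "det (replace_row A r c) = cofactor A r c"
proof -
  have "det (replace_row A r c) = (\<Sum>j<n. (if j = c then 1 else 0) * cofactor A r j)"
    using A by (subst det_row_linear[OF A r, symmetric]) (simp add: replace_row_def)
  also have "\<dots> = (\<Sum>j<n. if j = c then cofactor A r j else 0)"
    by (rule sum.cong) auto
  finally show ?thesis using c by simp
qed

lemma det_eq_0_if_mult_vec:
  fixes A :: "'a :: idom mat"
  assumes A: "A \<in> carrier_mat n n" and "\<And>i. i < n \<Longrightarrow> (\<Sum>j<n. A $$ (i, j) * v j) = 0"
    and "k < n" "v k \<noteq> 0"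
  shows "det A = 0"
proof -
  have "A *\<^sub>v vec n v = 0\<^sub>v n"
    using assms by (intro eq_vecI) (auto simp: scalar_prod_def atLeast0LessThan)
  moreover have "vec n v \<noteq> 0\<^sub>v n"
    using assms(3,4) by (metis index_vec index_zero_vec(1))
  ultimately show ?thesis
    using det_0_iff_vec_prod_zero[OF A] by (metis vec_carrier)
qed

lemma det_eq_0_if_vec_mult:
  fixes A :: "'a :: idom mat"
  assumes A: "A \<in> carrier_mat n n" and "\<And>j. j < n \<Longrightarrow> (\<Sum>i<n. v i * A $$ (i, j)) = 0"
    and "k < n" "v k \<noteq> 0"
  shows "det A = 0"
proof -
  have "det (transpose_mat A) = 0"
    by (rule det_eq_0_if_mult_vec[of _ n v k]) (use assms in \<open>auto simp: mult.commute\<close>)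
  then show ?thesis using det_transpose[OF A] by simp
qed

text \<open>A row with entry sum 0 put in place of row \<open>r\<close> keeps the all-ones vector in
  the kernel. Taking the unit vector at \<open>c\<close> minus the one at 0 makes the determinant a
  difference of two cofactors, which must vanish. The columns are handled in the same way with the
  left null vector \<open>\<tau>\<close>.\<close>

lemma cofactor_null_vectors:
  fixes A :: "'a :: idom mat"
  assumes A: "A \<in> carrier_mat n n"
    and row: "\<And>i. i < n \<Longrightarrow> (\<Sum>j<n. A $$ (i, j)) = 0"
    and col: "\<And>j. j < n \<Longrightarrow> (\<Sum>i<n. \<tau> i * A $$ (i, j)) = 0"
    and \<tau>: "\<tau> 0 = 1" and r: "r < n" and c: "c < n"
  shows "cofactor A r c = \<tau> r * cofactor A 0 0"
proof -
  have n: "0 < n" using r by simp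
  define v where "v = (\<lambda>j. (if j = c then 1 else 0) - (if j = 0 then 1 else 0 :: 'a))"
  define w where "w = (\<lambda>i. (if i = r then 1 else 0) - (if i = 0 then \<tau> r else 0 :: 'a))"
  have sv: "(\<Sum>j<n. v j * f j) = f c - f 0" for f
    using c n by (simp add: v_def left_diff_distrib sum_subtractf if_distrib[of "\<lambda>x. x * _"] cong: if_cong)
  have sw: "(\<Sum>j<n. f j * w j) = f r - f 0 * \<tau> r" for f
    using r n by (simp add: w_def right_diff_distrib sum_subtractf if_distrib[of "\<lambda>x. _ * x"] cong: if_cong)
  have "det (mat n n (\<lambda>(i, j). if i = r then v j else A $$ (i, j))) = 0"
  proof (rule det_eq_0_if_mult_vec[where v = "\<lambda>_. 1" and k = 0 and n = n], goal_cases)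
    case (2 i)
    then show ?case
      using row[of i] sv[of "\<lambda>_. 1"] by (cases "i = r") auto
  qed (use n in auto)
  then have "(\<Sum>j<n. v j * cofactor A r j) = 0"
    using det_row_linear[OF A r, of v] by simp
  then have 1: "cofactor A r c = cofactor A r 0"
    by (simp add: sv)
  have "det (mat n n (\<lambda>(i, j). if j = 0 then w i else A $$ (i, j))) = 0"
  proof (rule det_eq_0_if_vec_mult[where v = \<tau> and k = 0 and n = n], goal_cases)
    case (2 j)
    then show ?case
      using col[of j] sw[of \<tau>] \<tau> n by (cases "j = 0") auto
  qed (use n \<tau> in auto)
  then have "(\<Sum>i<n. cofactor A i 0 * w i) = 0"
    using det_col_linear[OF A n, of w] by (simp add: mult.commute[of "w _"])
  then have "cofactor A r 0 = \<tau> r * cofactor A 0 0"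
    using sw[of "\<lambda>i. cofactor A i 0"] by (simp add: mult.commute)
  with 1 show ?thesis by simp
qed

text \<open>The potential \<open>H\<close> forces every permutation other than \<open>\<pi>\<close> to contribute zero to the
  Leibniz formula.\<close>
lemma det_single_permutation:
  fixes M :: "'a :: comm_ring_1 mat" and H :: "nat \<Rightarrow> nat"
  assumes M: "M \<in> carrier_mat n n" and \<pi>: "\<pi> permutes {0..<n}"
    and H: "\<And>a b. a < n \<Longrightarrow> b < n \<Longrightarrow> M $$ (a, \<pi> b) \<noteq> 0 \<Longrightarrow> a = b \<or> H a < H b"
  shows "det M = signof \<pi> * (\<Prod>a = 0..<n. M $$ (a, \<pi> a))"
proof -
  have z: "(\<Prod>i = 0..<n. M $$ (i, p i)) = 0" if p: "p permutes {0..<n}" "p \<noteq> \<pi>" for p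
  proof (rule ccontr)
    assume nz: "(\<Prod>i = 0..<n. M $$ (i, p i)) \<noteq> 0"
    define q where "q = Hilbert_Choice.inv \<pi> \<circ> p"
    have q: "q permutes {0..<n}"
      unfolding q_def using permutes_compose[OF p(1) permutes_inv[OF \<pi>]] .
    have \<pi>q: "\<pi> (q i) = p i" for i
      by (simp add: q_def permutes_inverses(1)[OF \<pi>])
    have step: "i = q i \<or> H i < H (q i)" if "i < n" for i
    proof (rule H)
      show "q i < n" using permutes_in_image[OF q] that by simp
      show "M $$ (i, \<pi> (q i)) \<noteq> 0"
      proof
        assume "M $$ (i, \<pi> (q i)) = 0"
        then have "(\<Prod>i = 0..<n. M $$ (i, p i)) = 0"
          using that \<pi>q by (intro prod_zero) (auto intro!: bexI[of _ i])
        then show False using nz by simp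
      qed
    qed (rule that)
    have "(\<Sum>i = 0..<n. H (q i)) = (\<Sum>i = 0..<n. H i)"
      using sum.permute[OF q, of H] by (simp add: comp_def)
    moreover obtain i where i: "i < n" "q i \<noteq> i"
    proof -
      have "q \<noteq> id" using \<pi>q p(2) by (metis eq_id_iff ext)
      then obtain i where "q i \<noteq> i" by (auto simp: fun_eq_iff)
      moreover then have "i < n" using q by (meson atLeastLessThan_iff leI permutes_not_in zero_le)
      ultimately show ?thesis using that by blast
    qed
    have "(\<Sum>i = 0..<n. H i) < (\<Sum>i = 0..<n. H (q i))"
    proof (rule sum_strict_mono_ex1)
      show "\<forall>x\<in>{0..<n}. H x \<le> H (q x)" using step by (metis atLeastLessThan_iff le_refl less_imp_le)
      show "\<exists>a\<in>{0..<n}. H a < H (q a)" using step[OF i(1)] i by (intro bexI[of _ i]) auto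
    qed simp
    ultimately show False by simp
  qed
  have "det M = (\<Sum>p\<in>{p. p permutes {0..<n}}. if p = \<pi> then signof p * (\<Prod>i = 0..<n. M $$ (i, p i)) else 0)"
    unfolding det_def'[OF M] by (rule sum.cong) (auto simp: z)
  also have "\<dots> = signof \<pi> * (\<Prod>a = 0..<n. M $$ (a, \<pi> a))"
    using \<pi> by (simp add: finite_permutations)
  finally show ?thesis .
qed

lemma det_potential:
  fixes M :: "'a :: comm_ring_1 mat" and H :: "nat \<Rightarrow> nat"
  assumes M: "M \<in> carrier_mat n n" and "\<And>a. a < n \<Longrightarrow> M $$ (a, a) = 1"
    and "\<And>a b. a < n \<Longrightarrow> b < n \<Longrightarrow> M $$ (a, b) \<noteq> 0 \<Longrightarrow> a = b \<or> H a < H b"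
  shows "det M = 1"
  using det_single_permutation[OF M permutes_id, of H] assms(2,3) by simp

section \<open>Top coefficients of determinants of polynomial matrices\<close>

lemma coeff_prod_sum:
  fixes f :: "'b \<Rightarrow> 'a :: comm_ring_1 poly"
  assumes "finite I" "\<And>i. i \<in> I \<Longrightarrow> degree (f i) \<le> r i"
  shows "degree (\<Prod>i\<in>I. f i) \<le> (\<Sum>i\<in>I. r i) \<and>
    coeff (\<Prod>i\<in>I. f i) (\<Sum>i\<in>I. r i) = (\<Prod>i\<in>I. coeff (f i) (r i))"
  using assms
proof (induction I rule: finite_induct)
  case (insert x F)
  have d: "degree (f x) \<le> r x" "degree (\<Prod>i\<in>F. f i) \<le> (\<Sum>i\<in>F. r i)"
    using insert by auto
  have "degree (f x * (\<Prod>i\<in>F. f i)) \<le> r x + (\<Sum>i\<in>F. r i)"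
    using degree_mult_le[of "f x" "\<Prod>i\<in>F. f i"] d by linarith
  moreover have "coeff (f x * (\<Prod>i\<in>F. f i)) (r x + (\<Sum>i\<in>F. r i)) =
      coeff (f x) (r x) * coeff (\<Prod>i\<in>F. f i) (\<Sum>i\<in>F. r i)"
  proof -
    have "coeff (f x * (\<Prod>i\<in>F. f i)) (r x + (\<Sum>i\<in>F. r i)) =
      (\<Sum>k\<le>r x + (\<Sum>i\<in>F. r i). coeff (f x) k * coeff (\<Prod>i\<in>F. f i) (r x + (\<Sum>i\<in>F. r i) - k))"
      by (rule coeff_mult)
    also have "\<dots> = (\<Sum>k\<in>{r x}. coeff (f x) k * coeff (\<Prod>i\<in>F. f i) (r x + (\<Sum>i\<in>F. r i) - k))"
    proof (rule sum.mono_neutral_right)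
      show "\<forall>k\<in>{..r x + (\<Sum>i\<in>F. r i)} - {r x}.
        coeff (f x) k * coeff (\<Prod>i\<in>F. f i) (r x + (\<Sum>i\<in>F. r i) - k) = 0"
      proof
        fix k assume k: "k \<in> {..r x + (\<Sum>i\<in>F. r i)} - {r x}"
        show "coeff (f x) k * coeff (\<Prod>i\<in>F. f i) (r x + (\<Sum>i\<in>F. r i) - k) = 0"
        proof (cases "k < r x")
          case True
          then have "degree (\<Prod>i\<in>F. f i) < r x + (\<Sum>i\<in>F. r i) - k" using d by linarith
          then show ?thesis by (simp add: coeff_eq_0)
        next
          case False
          then have "degree (f x) < k" using d k by auto
          then show ?thesis by (simp add: coeff_eq_0)
        qed
      qed
    qed auto
    finally show ?thesis by simp
  qed
  ultimately show ?case using insert by simp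
qed simp

text \<open>In each Leibniz term row \<open>i\<close> contributes degree at most \<open>r i\<close>,
  so the coefficient at the sum of the bounds only sees the coefficients at the individual
  bounds.\<close>

lemma
  fixes M :: "'a :: comm_ring_1 poly mat"
  assumes M: "M \<in> carrier_mat n n"
    and deg: "\<And>i j. i < n \<Longrightarrow> j < n \<Longrightarrow> degree (M $$ (i, j)) \<le> r i"
  shows degree_det_le_sum: "degree (det M) \<le> (\<Sum>i = 0..<n. r i)" (is ?deg)
    and coeff_det_sum: "coeff (det M) (\<Sum>i = 0..<n. r i) =
      det (mat n n (\<lambda>(i, j). coeff (M $$ (i, j)) (r i)))" (is ?coeff)
proof -
  have s: "signof p = [:signof p :: 'a:]" for p :: "nat \<Rightarrow> nat"
    by (simp add: sign_def one_pCons)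
  have P: "degree (\<Prod>i = 0..<n. M $$ (i, p i)) \<le> (\<Sum>i = 0..<n. r i) \<and>
    coeff (\<Prod>i = 0..<n. M $$ (i, p i)) (\<Sum>i = 0..<n. r i) = (\<Prod>i = 0..<n. coeff (M $$ (i, p i)) (r i))"
    if "p permutes {0..<n}" for p
    by (rule coeff_prod_sum) (use that deg permutes_in_image in fastforce)+
  show ?deg
    unfolding det_def'[OF M] s
    by (rule degree_sum_le) (use P in \<open>auto simp: finite_permutations intro: order_trans[OF degree_smult_le]\<close>)
  have "coeff (det M) (\<Sum>i = 0..<n. r i) =
    (\<Sum>p\<in>{p. p permutes {0..<n}}. signof p * (\<Prod>i = 0..<n. coeff (M $$ (i, p i)) (r i)))"
    unfolding det_def'[OF M] s coeff_sum by (rule sum.cong) (use P in auto)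
  also have "\<dots> = det (mat n n (\<lambda>(i, j). coeff (M $$ (i, j)) (r i)))"
    by (subst det_def'[of _ n], simp, rule sum.cong)
      (auto intro!: prod.cong arg_cong2[where f = "(*)"] simp: permutes_in_image)
  finally show ?coeff .
qed

section \<open>Burau matrices of Lorenz permutations\<close>

text \<open>A weakly increasing list \<open>d\<close> encodes a Lorenz permutation: the over strand starting at \<open>i\<close>
  ends at \<open>i + d ! i\<close>, so it crosses the first \<open>d ! i\<close> under strands. The under strands start at
  \<open>length d + j\<close> and fill the remaining bottom points in order; the \<open>j\<close>-th of them passes under
  all over strands except the first \<open>overshoot d j\<close>. For a knot the last over strand
  crosses every under strand, so the number of under strands is \<open>last d\<close>.\<close>

definition overshoot :: "nat list \<Rightarrow> nat \<Rightarrow> nat" where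
  "overshoot d j = card {i. i < length d \<and> d ! i \<le> j}"

definition shuffle :: "nat list \<Rightarrow> nat \<Rightarrow> nat" where
  "shuffle d i = (if i < length d then i + d ! i else (i - length d) + overshoot d (i - length d))"

definition strands :: "nat list \<Rightarrow> nat" where
  "strands d = length d + last d"

text \<open>Jones's random walk: at each crossing a walker on the over strand stays there with weight \<open>t\<close>
  and drops to the under strand with weight \<open>1 - t\<close>, after which it never leaves that strand.\<close>

definition burau_entry :: "'a :: comm_ring_1 \<Rightarrow> nat list \<Rightarrow> nat \<Rightarrow> nat \<Rightarrow> 'a" where
  "burau_entry t d i k =
    (if i < length d
     then (if k = shuffle d i then t ^ (d ! i) else 0) +
          (\<Sum>j<d ! i. if k = shuffle d (length d + j) then (1 - t) * t ^ j else 0)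
     else (if k = shuffle d i then 1 else 0))"

definition alex_mat :: "'a :: comm_ring_1 \<Rightarrow> nat list \<Rightarrow> 'a mat" where
  "alex_mat t d = mat (strands d) (strands d)
     (\<lambda>(i, k). (if i = k then 1 else 0) - burau_entry t d i k)"

definition alex :: "'a :: comm_ring_1 \<Rightarrow> nat list \<Rightarrow> 'a" where
  "alex t d = cofactor (alex_mat t d) 0 0"

text \<open>An over strand of displacement 0 would end where it starts and close up to a component
  of its own.\<close>

definition shape :: "nat list \<Rightarrow> bool" where
  "shape d \<longleftrightarrow> d \<noteq> [] \<and> sorted d \<and> (\<forall>x\<in>set d. 1 \<le> x)"

lemma alex_mat_carrier [simp]: "alex_mat t d \<in> carrier_mat (strands d) (strands d)"
  by (simp add: alex_mat_def)

text \<open>Sortedness makes the counted indices a down-set, hence an initial segment. This converts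
  the cardinality \<open>overshoot d j\<close> into a comparison of indices.\<close>

lemma overshoot_set:
  assumes "sorted d"
  shows "{i. i < length d \<and> d ! i \<le> j} = {..<overshoot d j}"
proof -
  define S where "S = {i. i < length d \<and> d ! i \<le> j}"
  have fin: "finite S" by (simp add: S_def)
  have down: "i \<in> S" if "k \<in> S" "i \<le> k" for i k
    using that assms by (auto simp: S_def intro: order_trans[OF sorted_nth_mono])
  have "S = {..<card S}"
  proof (cases "S = {}")
    case False
    have "S = {..Max S}"
      using down Max_in[OF fin False] Max_ge[OF fin] by auto
    then show ?thesis by (metis card_atMost lessThan_Suc_atMost)
  qed simp
  then show ?thesis by (simp add: S_def overshoot_def)
qed

lemma less_overshoot_iff:
  assumes "sorted d" "i < length d"
  shows "i < overshoot d j \<longleftrightarrow> d ! i \<le> j"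
  using overshoot_set[OF assms(1), of j] assms(2) by auto

lemma overshoot_le_length: "overshoot d j \<le> length d"
  using card_mono[of "{..<length d}" "{i. i < length d \<and> d ! i \<le> j}"] by (auto simp: overshoot_def)

lemma overshoot_mono: "j \<le> j' \<Longrightarrow> overshoot d j \<le> overshoot d j'"
  unfolding overshoot_def by (rule card_mono) auto

lemma sorted_le_last: "sorted d \<Longrightarrow> i < length d \<Longrightarrow> d ! i \<le> last d"
  by (cases d rule: rev_cases) (auto simp: sorted_append nth_append less_Suc_eq_le)

lemma overshoot_less_length:
  assumes "d \<noteq> []" "sorted d" "j < last d"
  shows "overshoot d j < length d"
proof -
  have "0 < length d" using assms(1) by simp
  moreover have "d ! (length d - 1) = last d" using assms(1) by (simp add: last_conv_nth)
  ultimately have "\<not> length d - 1 < overshoot d j"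
    using less_overshoot_iff[OF assms(2), of "length d - 1" j] assms(3) by simp
  then show ?thesis using \<open>0 < length d\<close> by linarith
qed

lemma shuffle_over: "i < length d \<Longrightarrow> shuffle d i = i + d ! i"
  by (simp add: shuffle_def)

lemma shuffle_under: "shuffle d (length d + j) = j + overshoot d j"
  by (simp add: shuffle_def)

text \<open>The crossing criterion: over strands start to the left of under strands, so over strand
  \<open>i\<close> crosses the \<open>j\<close>-th under strand exactly when their ends are
  reversed, that is, when \<open>j < d ! i\<close>.\<close>

lemma shuffle_over_less_under_iff:
  assumes "sorted d" "i < length d"
  shows "shuffle d i < shuffle d (length d + j) \<longleftrightarrow> d ! i \<le> j"
    and "shuffle d (length d + j) < shuffle d i \<longleftrightarrow> j < d ! i"
  using less_overshoot_iff[OF assms, of j] assms(2)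
  by (auto simp: shuffle_over shuffle_under)

lemma shuffle_less:
  assumes "d \<noteq> []" "sorted d" "i < strands d"
  shows "shuffle d i < strands d"
proof (cases "i < length d")
  case True
  then show ?thesis
    using sorted_le_last[OF assms(2) True] by (simp add: shuffle_over strands_def)
next
  case False
  then show ?thesis
    using overshoot_le_length[of d "i - length d"] assms(3)
    by (simp add: shuffle_def strands_def)
qed

lemma shuffle_inj:
  assumes "sorted d"
  shows "inj (shuffle d)"
proof (rule linorder_injI)
  fix x y :: nat assume xy: "x < y"
  consider "y < length d" | "x < length d" "length d \<le> y" | "length d \<le> x"
    by linarith
  then show "shuffle d x \<noteq> shuffle d y"
  proof cases
    case 1
    then show ?thesis
      using xy sorted_nth_mono[OF assms, of x y] by (simp add: shuffle_over)
  next
    case 2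
    then show ?thesis
      using shuffle_over_less_under_iff[OF assms 2(1), of "y - length d"]
      by (metis le_add_diff_inverse linorder_not_less order_less_irrefl)
  next
    case 3
    then show ?thesis
      using xy overshoot_mono[OF diff_le_mono[of x y "length d"], of d]
      by (simp add: shuffle_def)
  qed
qed

lemma shuffle_bij:
  assumes "d \<noteq> []" "sorted d"
  shows "bij_betw (shuffle d) {..<strands d} {..<strands d}"
proof -
  have "inj_on (shuffle d) {..<strands d}"
    using shuffle_inj[OF assms(2)] by (rule inj_on_subset) simp
  moreover have "shuffle d ` {..<strands d} \<subseteq> {..<strands d}"
    using shuffle_less[OF assms] by auto
  ultimately show ?thesis
    by (simp add: bij_betw_def endo_inj_surj)
qed

section \<open>Null vectors of the Alexander matrix\<close>

lemma sum_one_minus_power: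
  fixes t :: "'a :: comm_ring_1"
  shows "(\<Sum>j<n. (1 - t) * t ^ j) = 1 - t ^ n"
  by (simp add: one_diff_power_eq sum_distrib_left)

text \<open>No walker is lost: the weights of dropping onto the successive under strands telescope
  against the weight \<open>t ^ (d ! i)\<close> of staying on top to the end.\<close>

lemma burau_entry_row_sum:
  assumes "d \<noteq> []" "sorted d" "i < strands d"
  shows "(\<Sum>k<strands d. burau_entry t d i k) = 1"
proof (cases "i < length d")
  case True
  have s: "shuffle d (length d + j) < strands d" if "j < d ! i" for j
    using sorted_le_last[OF assms(2) True] that assms(1,2)
    by (intro shuffle_less) (auto simp: strands_def)
  have "(\<Sum>k<strands d. burau_entry t d i k) =
      t ^ (d ! i) + (\<Sum>k<strands d. \<Sum>j<d ! i. if k = shuffle d (length d + j) then (1 - t) * t ^ j else 0)"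
    using True shuffle_less[OF assms] by (simp add: burau_entry_def sum.distrib)
  also have "(\<Sum>k<strands d. \<Sum>j<d ! i. if k = shuffle d (length d + j) then (1 - t) * t ^ j else 0) =
      (\<Sum>j<d ! i. (1 - t) * t ^ j)"
    by (subst sum.swap) (use s in simp)
  finally show ?thesis by (simp add: sum_one_minus_power)
next
  case False
  then show ?thesis using shuffle_less[OF assms] by (simp add: burau_entry_def)
qed

lemma sum_lessThan_add:
  fixes f :: "nat \<Rightarrow> 'a :: comm_monoid_add"
  shows "(\<Sum>i<p + q. f i) = (\<Sum>i<p. f i) + (\<Sum>j<q. f (p + j))"
  by (induction q) (simp_all add: add.assoc)

text \<open>Every Burau generator fixes the row vector of powers of \<open>t\<close>. In the closed
  form this reads as follows: under strand \<open>j\<close> is crossed by the over strands from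
  index \<open>overshoot d j\<close> on, and the geometric sum of their contributions is exactly the
  difference between the power of \<open>t\<close> at its end and that at its start.\<close>

lemma burau_entry_col_sum:
  assumes "d \<noteq> []" "sorted d" "k < strands d"
  shows "(\<Sum>i<strands d. t ^ i * burau_entry t d i k) = t ^ k"
proof -
  let ?p = "length d" let ?q = "last d"
  let ?I = "\<lambda>x y. if k = x then y else 0"
  have split_sum: "(\<Sum>i<strands d. f i) = (\<Sum>i<?p. f i) + (\<Sum>j<?q. f (?p + j))" for f :: "nat \<Rightarrow> 'a"
    unfolding strands_def by (rule sum_lessThan_add)
  have geom: "(\<Sum>i<n. t ^ i * ((1 - t) * t ^ j)) = (1 - t ^ n) * t ^ j" for n j
    unfolding sum_one_minus_power[symmetric] sum_distrib_right by (simp add: ac_simps)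
  have tail: "(\<Sum>i<?p. if j < d ! i then t ^ i * ((1 - t) * t ^ j) else 0) =
      t ^ shuffle d (?p + j) - t ^ (?p + j)" for j
  proof -
    have "(\<Sum>i<?p. if j < d ! i then t ^ i * ((1 - t) * t ^ j) else 0) =
        (\<Sum>i<?p. if i < overshoot d j then 0 else t ^ i * ((1 - t) * t ^ j))"
      by (rule sum.cong) (auto simp: less_overshoot_iff[OF assms(2)])
    also have "\<dots> = (\<Sum>i<?p. t ^ i * ((1 - t) * t ^ j)) - (\<Sum>i<overshoot d j. t ^ i * ((1 - t) * t ^ j))"
    proof -
      have "(\<Sum>i<?p. t ^ i * ((1 - t) * t ^ j)) =
        (\<Sum>i<?p. if i < overshoot d j then 0 else t ^ i * ((1 - t) * t ^ j)) +
        (\<Sum>i<?p. if i < overshoot d j then t ^ i * ((1 - t) * t ^ j) else 0)"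
        unfolding sum.distrib[symmetric] by (rule sum.cong) auto
      moreover have "(\<Sum>i<?p. if i < overshoot d j then t ^ i * ((1 - t) * t ^ j) else 0) =
        (\<Sum>i<overshoot d j. t ^ i * ((1 - t) * t ^ j))"
        by (rule sum.mono_neutral_cong_right) (use overshoot_le_length[of d j] in auto)
      ultimately show ?thesis by simp
    qed
    also have "\<dots> = ((1 - t ^ ?p) - (1 - t ^ overshoot d j)) * t ^ j"
      unfolding geom by (simp add: algebra_simps)
    also have "\<dots> = t ^ shuffle d (?p + j) - t ^ (?p + j)"
      unfolding shuffle_under by (simp add: power_add algebra_simps)
    finally show ?thesis .
  qed
  have "(\<Sum>i<?p. t ^ i * burau_entry t d i k) =
      (\<Sum>i<?p. ?I (shuffle d i) (t ^ shuffle d i)) +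
      (\<Sum>i<?p. \<Sum>j<d ! i. ?I (shuffle d (?p + j)) (t ^ i * ((1 - t) * t ^ j)))"
    unfolding sum.distrib[symmetric]
    by (rule sum.cong)
      (auto simp: burau_entry_def distrib_left sum_distrib_left shuffle_over power_add intro!: sum.cong)
  also have "(\<Sum>i<?p. \<Sum>j<d ! i. ?I (shuffle d (?p + j)) (t ^ i * ((1 - t) * t ^ j))) =
      (\<Sum>i<?p. \<Sum>j<?q. ?I (shuffle d (?p + j)) (if j < d ! i then t ^ i * ((1 - t) * t ^ j) else 0))"
  proof (rule sum.cong)
    fix i assume "i \<in> {..<?p}"
    then have "d ! i \<le> ?q" using sorted_le_last[OF assms(2)] by simp
    then show "(\<Sum>j<d ! i. ?I (shuffle d (?p + j)) (t ^ i * ((1 - t) * t ^ j))) =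
      (\<Sum>j<?q. ?I (shuffle d (?p + j)) (if j < d ! i then t ^ i * ((1 - t) * t ^ j) else 0))"
      by (intro sum.mono_neutral_cong_left) auto
  qed simp
  also have "\<dots> = (\<Sum>j<?q. ?I (shuffle d (?p + j)) (t ^ shuffle d (?p + j) - t ^ (?p + j)))"
    unfolding tail[symmetric] by (subst sum.swap) (auto intro!: sum.cong)
  finally have over: "(\<Sum>i<?p. t ^ i * burau_entry t d i k) =
      (\<Sum>i<?p. ?I (shuffle d i) (t ^ shuffle d i)) +
      (\<Sum>j<?q. ?I (shuffle d (?p + j)) (t ^ shuffle d (?p + j) - t ^ (?p + j)))" .
  have "(\<Sum>i<strands d. t ^ i * burau_entry t d i k) =
      (\<Sum>i<?p. ?I (shuffle d i) (t ^ shuffle d i)) +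
      ((\<Sum>j<?q. ?I (shuffle d (?p + j)) (t ^ shuffle d (?p + j) - t ^ (?p + j))) +
      (\<Sum>j<?q. t ^ (?p + j) * burau_entry t d (?p + j) k))"
    unfolding split_sum over by (simp add: add.assoc)
  also have "\<dots> = (\<Sum>i<?p. ?I (shuffle d i) (t ^ shuffle d i)) +
      (\<Sum>j<?q. ?I (shuffle d (?p + j)) (t ^ shuffle d (?p + j)))"
    unfolding sum.distrib[symmetric]
    by (rule arg_cong2[where f = "(+)"]) (auto simp: burau_entry_def intro!: sum.cong)
  also have "\<dots> = (\<Sum>i<strands d. ?I (shuffle d i) (t ^ shuffle d i))"
    unfolding split_sum ..
  also have "\<dots> = (\<Sum>x<strands d. ?I x (t ^ x))"
    using sum.reindex_bij_betw[OF shuffle_bij[OF assms(1,2)], of "\<lambda>x. ?I x (t ^ x)"] .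
  finally show ?thesis using assms(3) by simp
qed

text \<open>The rows of the Alexander matrix sum to zero and \<open>(1, t, t\<^sup>2, \<dots>)\<close> is a left null vector.\<close>

lemma cofactor_alex_mat:
  fixes t :: "'a :: idom"
  assumes "d \<noteq> []" "sorted d" "r < strands d" "c < strands d"
  shows "cofactor (alex_mat t d) r c = t ^ r * alex t d"
  unfolding alex_def
proof (rule cofactor_null_vectors[OF alex_mat_carrier _ _ _ assms(3,4)])
  fix i assume i: "i < strands d"
  then have "(\<Sum>j<strands d. alex_mat t d $$ (i, j)) =
      (\<Sum>j<strands d. if i = j then 1 else 0) - (\<Sum>j<strands d. burau_entry t d i j)"
    by (simp add: alex_mat_def sum_subtractf)
  then show "(\<Sum>j<strands d. alex_mat t d $$ (i, j)) = 0"
    using i burau_entry_row_sum[OF assms(1,2) i, of t] by simp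
next
  fix j assume j: "j < strands d"
  then have "(\<Sum>i<strands d. t ^ i * alex_mat t d $$ (i, j)) =
      (\<Sum>i<strands d. if i = j then t ^ i else 0) - (\<Sum>i<strands d. t ^ i * burau_entry t d i j)"
    unfolding sum_subtractf[symmetric]
    by (intro sum.cong) (auto simp: alex_mat_def right_diff_distrib)
  then show "(\<Sum>i<strands d. t ^ i * alex_mat t d $$ (i, j)) = 0"
    using j burau_entry_col_sum[OF assms(1,2) j, of t] by simp
qed simp

section \<open>Destabilisation\<close>

lemma overshoot_Cons_1: "shape d \<Longrightarrow> overshoot (Suc 0 # d) (Suc j) = Suc (overshoot d (Suc j))"
proof -
  have "{i. i < length (Suc 0 # d) \<and> (Suc 0 # d) ! i \<le> Suc j} = insert 0 (Suc ` {i. i < length d \<and> d ! i \<le> Suc j})"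
    by (auto simp: nth_Cons' image_iff less_Suc_eq_0_disj split: if_splits)
  then show ?thesis by (simp add: overshoot_def card_image)
qed

lemma overshoot_0: "shape d \<Longrightarrow> overshoot d 0 = 0"
proof -
  assume "shape d"
  then have "1 \<le> d ! i" if "i < length d" for i using that by (simp add: shape_def)
  then have "{i. i < length d \<and> d ! i \<le> 0} = {}" by fastforce
  then show ?thesis unfolding overshoot_def by simp
qed

lemma shape_Cons_1: "shape d \<Longrightarrow> shape (Suc 0 # d)"
  by (auto simp: shape_def)

text \<open>The new over strand crosses only the first under strand, so all others are shifted by
  one. The first under strand, at index \<open>length d\<close>, is the exception: it ends at 0
  before and after.\<close>

lemma shuffle_Cons_1:
  assumes "shape d" "i \<noteq> length d"
  shows "shuffle (Suc 0 # d) (Suc i) = Suc (shuffle d i)"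
proof (cases "i < length d")
  case False
  then obtain j where "i = length d + Suc j"
    using assms(2) by (metis less_imp_Suc_add linorder_neqE_nat add_Suc_right)
  then show ?thesis using overshoot_Cons_1[OF assms(1)] by (simp add: shuffle_def)
qed (simp add: shuffle_def)

lemma shuffle_first_under: "shape d \<Longrightarrow> shuffle d (length d) = 0"
  by (simp add: shuffle_def overshoot_0)

lemma burau_entry_Cons_1:
  assumes d: "shape d" and k: "k \<noteq> 0"
  shows "burau_entry t (Suc 0 # d) (Suc i) (Suc k) = burau_entry t d i k"
proof -
  have *: "Suc k = shuffle (Suc 0 # d) (Suc i) \<longleftrightarrow> k = shuffle d i" for i
    using shuffle_Cons_1[OF d, of i] shuffle_first_under[OF d]
      shuffle_first_under[OF shape_Cons_1[OF d]] k
    by (cases "i = length d") auto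
  show ?thesis by (simp add: burau_entry_def *)
qed

lemma strands_ge_2: "shape d \<Longrightarrow> 2 \<le> strands d"
  using last_in_set[of d] by (cases d) (auto simp: shape_def strands_def)

text \<open>The first over strand and the first under strand exchange the bottom points 0 and 1. Row
  0 of the Alexander matrix is therefore supported on columns 0 and 1, with entry \<open>t\<close>
  in column 0. In the cofactor at \<open>(1, 1)\<close> this row has only that entry left; expanding
  along it removes the strand, and the factor \<open>t\<close> cancels against the one that
  \<open>cofactor_alex_mat\<close> gives for row 1.\<close>

lemma alex_Cons_1:
  fixes t :: "'a :: idom"
  assumes d: "shape d" and t: "t \<noteq> 0"
  shows "alex t (Suc 0 # d) = alex t d"
proof -
  define m where "m = strands d"
  have s: "strands (Suc 0 # d) = Suc m" using d by (simp add: strands_def m_def shape_def)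
  have m: "2 \<le> m" using strands_ge_2[OF d] by (simp add: m_def)
  let ?A = "alex_mat t (Suc 0 # d)"
  let ?N = "mat_delete ?A 1 1"
  have A: "?A \<in> carrier_mat (Suc m) (Suc m)" by (metis alex_mat_carrier s)
  have N: "?N \<in> carrier_mat m m" using mat_delete_carrier[OF A] by simp
  have "t ^ 1 * alex t (Suc 0 # d) = cofactor ?A 1 1"
    using shape_Cons_1[OF d] s m
    by (intro cofactor_alex_mat[symmetric]) (auto simp: shape_def)
  also have "\<dots> = det ?N" by (simp add: cofactor_def)
  also have "\<dots> = (\<Sum>j<m. ?N $$ (0, j) * cofactor ?N 0 j)"
    by (rule laplace_expansion_row[OF N]) (use m in simp)
  also have "\<dots> = (\<Sum>j<m. if j = 0 then t * cofactor ?N 0 0 else 0)"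
  proof (rule sum.cong)
    fix j assume j: "j \<in> {..<m}"
    have "burau_entry t (Suc 0 # d) 0 0 = 1 - t"
      using shuffle_first_under[OF shape_Cons_1[OF d]] by (simp add: burau_entry_def shuffle_def)
    moreover have "burau_entry t (Suc 0 # d) 0 (Suc j) = 0" if "j \<noteq> 0"
      using shuffle_first_under[OF shape_Cons_1[OF d]] that by (simp add: burau_entry_def shuffle_def)
    moreover have "?N $$ (0, j) = ?A $$ (0, if j = 0 then 0 else Suc j)"
      using A j m by (simp add: mat_delete_def)
    ultimately show "?N $$ (0, j) * cofactor ?N 0 j = (if j = 0 then t * cofactor ?N 0 0 else 0)"
      using j by (simp add: alex_mat_def s)
  qed simp
  also have "\<dots> = t * cofactor ?N 0 0" using m by simp
  also have "mat_delete ?N 0 0 = mat_delete (alex_mat t d) 0 0"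
    using A N m burau_entry_Cons_1[OF d, of "Suc _"]
    by (intro eq_matI) (auto simp: mat_delete_def alex_mat_def s m_def[symmetric])
  then have "cofactor ?N 0 0 = alex t d" by (simp add: cofactor_def alex_def)
  finally show ?thesis using t by simp
qed

lemma overshoot_snoc:
  assumes "j < q"
  shows "overshoot (c @ [q]) j = card {i. i < length c \<and> c ! i \<le> j}"
  unfolding overshoot_def
  by (rule arg_cong[where f = card]) (use assms in \<open>auto simp: nth_append less_Suc_eq\<close>)

text \<open>The additional under strand passes under the last over strand only, so it goes from
  \<open>m\<close> to \<open>m - 1\<close> and its row has just the entries 1 and -1 in these
  columns. Deleting column \<open>m - 1\<close> leaves a unit row to expand along; deleting row 0
  avoids any power of \<open>t\<close>.\<close>

lemma alex_snoc_Suc: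
  fixes t :: "'a :: idom"
  assumes d: "shape (c @ [q])"
  shows "alex t (c @ [Suc q]) = alex t (c @ [q])"
proof -
  let ?d = "c @ [q]" and ?d' = "c @ [Suc q]"
  define p where "p = length c"
  define m where "m = Suc (p + q)"
  have q: "1 \<le> q" and cq: "\<And>x. x \<in> set c \<Longrightarrow> x \<le> q" using d by (auto simp: shape_def sorted_append)
  have d': "shape ?d'" using d by (auto simp: shape_def sorted_append le_SucI)
  have s: "strands ?d = m" and s': "strands ?d' = Suc m"
    by (auto simp: strands_def m_def p_def)
  let ?A = "alex_mat t ?d'"
  let ?N = "mat_delete ?A 0 (m - 1)"
  have A: "?A \<in> carrier_mat (Suc m) (Suc m)" by (metis alex_mat_carrier s')
  have A0: "alex_mat t ?d \<in> carrier_mat m m" by (metis alex_mat_carrier s)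
  have N: "?N \<in> carrier_mat m m" using mat_delete_carrier[OF A] by simp
  have ov: "overshoot ?d' j = overshoot ?d j" if "j < q" for j
    using that by (simp add: overshoot_snoc)
  have "overshoot ?d' q = card {..<p}"
    unfolding overshoot_def using cq
    by (intro arg_cong[where f = card]) (auto simp: nth_append p_def less_Suc_eq)
  then have last_under: "shuffle ?d' m = m - 1"
    by (simp add: shuffle_def m_def p_def)
  \<comment> \<open>Among the rows below \<open>m\<close> only that of the last over strand changes:
    its end at \<open>m - 1\<close> with weight \<open>t ^ q\<close> is replaced by a drop to
    \<open>m - 1\<close> with weight \<open>(1 - t) * t ^ q\<close> and an end at \<open>m\<close>
    with weight \<open>t ^ Suc q\<close>. None of this touches a column below
    \<open>m - 1\<close>.\<close>
  have entry: "burau_entry t ?d' i k = burau_entry t ?d i k" if "i < m" "k < m - 1" for i k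
  proof -
    have lastk: "k \<noteq> q + overshoot ?d' q"
      using last_under that by (simp add: shuffle_def m_def p_def)
    consider "i < p" | "i = p" | "p < i" by linarith
    then show ?thesis
    proof cases
      case 1
      then have "c ! i \<le> q" using cq by (simp add: p_def)
      with 1 show ?thesis
        by (auto simp: burau_entry_def shuffle_def p_def nth_append ov intro!: sum.cong)
    next
      case 2
      have "(\<Sum>j<q. if k = shuffle ?d' (Suc p + j) then (1 - t) * t ^ j else 0) =
          (\<Sum>j<q. if k = shuffle ?d (Suc p + j) then (1 - t) * t ^ j else 0)"
        by (rule sum.cong) (auto simp: shuffle_def p_def ov)
      with 2 that lastk show ?thesis
        by (simp add: burau_entry_def shuffle_def p_def nth_append m_def)
    next
      case 3
      with that have "i - Suc p < q" by (auto simp: m_def)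
      with 3 show ?thesis by (simp add: burau_entry_def shuffle_def p_def ov)
    qed
  qed
  have row: "?A $$ (m, k) = (if k = m then 1 else 0) - (if k = m - 1 then 1 else 0)" if "k \<le> m" for k
    using that last_under by (auto simp: alex_mat_def s' burau_entry_def m_def p_def)
  have "alex t ?d' = cofactor ?A 0 (m - 1)"
    using cofactor_alex_mat[of ?d' 0 "m - 1" t] d' s' by (simp add: shape_def)
  also have "\<dots> = (- 1) ^ (m - 1) * det ?N" by (simp add: cofactor_def)
  also have "det ?N = (\<Sum>j<m. ?N $$ (m - 1, j) * cofactor ?N (m - 1) j)"
    by (rule laplace_expansion_row[OF N]) (simp add: m_def)
  also have "\<dots> = (\<Sum>j<m. if j = m - 1 then cofactor ?N (m - 1) (m - 1) else 0)"
  proof (rule sum.cong)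
    fix j assume j: "j \<in> {..<m}"
    have "?N $$ (m - 1, j) = ?A $$ (m, if j < m - 1 then j else Suc j)"
      using A j by (auto simp: mat_delete_def m_def)
    then have "?N $$ (m - 1, j) = (if j = m - 1 then 1 else 0)"
      using row j by (auto simp: m_def)
    then show "?N $$ (m - 1, j) * cofactor ?N (m - 1) j =
        (if j = m - 1 then cofactor ?N (m - 1) (m - 1) else 0)" by auto
  qed simp
  also have "\<dots> = cofactor ?N (m - 1) (m - 1)" by (simp add: m_def)
  also have "\<dots> = det (mat_delete ?N (m - 1) (m - 1))" by (simp add: cofactor_def)
  also have "mat_delete ?N (m - 1) (m - 1) = mat_delete (alex_mat t ?d) 0 (m - 1)"
    using A A0 N entry
    by (intro eq_matI) (auto simp: mat_delete_def alex_mat_def s s')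
  also have "(- 1) ^ (m - 1) * det (mat_delete (alex_mat t ?d) 0 (m - 1)) = cofactor (alex_mat t ?d) 0 (m - 1)"
    by (simp add: cofactor_def)
  also have "\<dots> = alex t ?d"
    using cofactor_alex_mat[of ?d 0 "m - 1" t] d s by (simp add: shape_def m_def)
  finally show ?thesis .
qed

section \<open>Extreme coefficients and degree\<close>

abbreviation (input) T :: "int poly" where "T \<equiv> [:0, 1:]"

lemma poly_burau_entry: "poly (burau_entry T d i k) x = burau_entry x d i k"
  by (simp add: burau_entry_def poly_sum if_distrib[of "\<lambda>p. poly p x"] cong: if_cong)

text \<open>Evaluation is a ring homomorphism and commutes with determinants. Since
  \<open>alex\<close> is defined over every commutative ring, the values of the polynomial at 0 and
  1 become determinants of integer matrices.\<close>

lemma poly_alex: "poly (alex T d) x = alex x d"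
proof -
  interpret h: comm_ring_hom "\<lambda>p :: int poly. poly p x"
    by unfold_locales auto
  have "map_mat (\<lambda>p. poly p x) (mat_delete (alex_mat T d) 0 0) = mat_delete (alex_mat x d) 0 0"
    by (intro eq_matI) (auto simp: mat_delete_def alex_mat_def poly_burau_entry)
  then show ?thesis
    using h.hom_det[of "mat_delete (alex_mat T d) 0 0"] by (simp add: alex_def cofactor_def)
qed

lemma replace_row_carrier [simp]: "A \<in> carrier_mat m n \<Longrightarrow> replace_row A r c \<in> carrier_mat m n"
  by (simp add: replace_row_def)

lemma replace_row_alex_mat:
  assumes "i < strands d" "j < strands d"
  shows "replace_row (alex_mat t d) r c $$ (i, j) =
    (if i = r then (if j = c then 1 else 0) else (if i = j then 1 else 0) - burau_entry t d i j)"
  using assms by (auto simp: replace_row_def alex_mat_def)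

text \<open>The last over strand crosses every under strand, so each under strand moves strictly to
  the left. The potentials for \<open>t = 0\<close> and for the top coefficient rest on
  this.\<close>

lemma shuffle_under_less:
  assumes "shape d" "length d \<le> i" "i < strands d"
  shows "shuffle d i < i"
proof -
  have "i - length d < last d" using assms by (auto simp: strands_def)
  then show ?thesis
    using overshoot_less_length[of d "i - length d"] assms by (simp add: shuffle_def shape_def)
qed

text \<open>At \<open>t = 0\<close> every walker on an over strand drops at its first crossing, onto
  the under strand that ends at 0. Hence all rows but row 0 lead to a smaller index, and with row 0
  replaced the matrix is triangular.\<close>

lemma alex_0:
  assumes d: "shape d"
  shows "alex (0 :: int) d = 1"
proof -
  define m where "m = strands d"
  have m: "0 < m" using strands_ge_2[OF d] by (simp add: m_def)
  let ?A = "alex_mat (0 :: int) d"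
  have A: "?A \<in> carrier_mat m m" unfolding m_def by (rule alex_mat_carrier)
  note RA = replace_row_alex_mat[of _ d, folded m_def]
  have entry: "burau_entry (0 :: int) d i k = (if k = (if i < length d then 0 else shuffle d i) then 1 else 0)"
    if "i < m" for i k
  proof (cases "i < length d")
    case True
    then have "1 \<le> d ! i" using d by (simp add: shape_def)
    then obtain e where e: "d ! i = Suc e" by (cases "d ! i") auto
    \<comment> \<open>Only the summand \<open>j = 0\<close> survives, because
      \<open>0 ^ 0 = 1\<close>.\<close>
    have "(\<Sum>j<d ! i. if k = shuffle d (length d + j) then (1 - 0) * (0 :: int) ^ j else 0) =
        (if k = 0 then 1 else 0)"
      unfolding e sum.lessThan_Suc_shift using shuffle_first_under[OF d]
      by (auto intro!: sum.neutral)
    with True e show ?thesis by (simp add: burau_entry_def)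
  qed (simp add: burau_entry_def)
  have lt: "(if i < length d then 0 else shuffle d i) < i" if "0 < i" "i < m" for i
    using that shuffle_under_less[OF d, of i] by (auto simp: m_def)
  have "det (replace_row ?A 0 0) = 1"
  proof (rule det_potential[where H = "\<lambda>i. m - i"])
    fix a assume a: "a < m"
    show "replace_row ?A 0 0 $$ (a, a) = 1"
      using a lt[of a] entry[OF a, of a]
      by (cases "a = 0") (auto simp: RA)
  next
    fix a b assume ab: "a < m" "b < m" "replace_row ?A 0 0 $$ (a, b) \<noteq> 0"
    show "a = b \<or> m - a < m - b"
    proof (cases "a = 0 \<or> a = b")
      case False
      then have "b = (if a < length d then 0 else shuffle d a)"
        using ab entry[OF ab(1), of b]
        by (auto simp: RA split: if_splits)
      then have "b < a" using lt[of a] False ab(1) by simp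
      then show ?thesis using ab by simp
    qed (use ab m in \<open>auto simp: RA split: if_splits\<close>)
  qed (use A in simp)
  then show ?thesis using det_replace_row[OF A m m] by (simp add: alex_def)
qed

text \<open>At \<open>t = 1\<close> the Burau matrix is a permutation matrix. For a single cycle
  enumerated by \<open>\<rho>\<close>, replacing the row of the last element cuts the cycle open,
  and the position along it is a potential. The power of \<open>t\<close> relating this cofactor to
  the one at \<open>(0, 0)\<close> is 1.\<close>

lemma alex_1:
  assumes d: "shape d" and m: "m = strands d"
    and \<rho>: "bij_betw \<rho> {..<m} {..<m}"
    and step: "\<And>k. Suc k < m \<Longrightarrow> shuffle d (\<rho> k) = \<rho> (Suc k)"
  shows "alex (1 :: int) d = 1"
proof -
  have m2: "2 \<le> m" using strands_ge_2[OF d] m by simp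
  define r where "r = \<rho> (m - 1)"
  define H where "H = the_inv_into {..<m} \<rho>"
  have inj: "inj_on \<rho> {..<m}" using \<rho> by (simp add: bij_betw_def)
  have H\<rho>: "H (\<rho> k) = k" if "k < m" for k
    using the_inv_into_f_f[OF inj] that by (simp add: H_def)
  have \<rho>m: "\<rho> k < m" if "k < m" for k using \<rho> that by (auto simp: bij_betw_def)
  have r: "r < m" using \<rho>m m2 by (simp add: r_def)
  let ?A = "alex_mat (1 :: int) d"
  have A: "?A \<in> carrier_mat m m" unfolding m by (rule alex_mat_carrier)
  note RA = replace_row_alex_mat[of _ d, folded m]
  have entry: "burau_entry (1 :: int) d i k = (if k = shuffle d i then 1 else 0)" for i k
    by (auto simp: burau_entry_def intro!: sum.neutral)
  have surj: "\<exists>k<m. a = \<rho> k" if "a < m" for a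
    using \<rho> that unfolding bij_betw_def by (metis image_iff lessThan_iff)
  have next_neq: "shuffle d (\<rho> k) = \<rho> (Suc k) \<and> \<rho> (Suc k) \<noteq> \<rho> k" if "Suc k < m" for k
    using step[OF that] H\<rho>[of k] H\<rho>[of "Suc k"] that by force
  have "det (replace_row ?A r r) = 1"
  proof (rule det_potential[where H = H])
    fix a assume a: "a < m"
    then obtain k where k: "k < m" "a = \<rho> k" using surj by blast
    show "replace_row ?A r r $$ (a, a) = 1"
    proof (cases "a = r")
      case False
      then have "k \<noteq> m - 1" using k by (auto simp: r_def)
      then have "Suc k < m" using k by simp
      then show ?thesis
        using False a next_neq[of k] k
        by (simp add: RA entry)
    qed (use a in \<open>simp add: RA\<close>)
  next
    fix a b assume ab: "a < m" "b < m" "replace_row ?A r r $$ (a, b) \<noteq> 0"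
    obtain k where k: "k < m" "a = \<rho> k" using surj ab by blast
    show "a = b \<or> H a < H b"
    proof (cases "a = r \<or> a = b")
      case False
      then have "k \<noteq> m - 1" using k by (auto simp: r_def)
      then have Sk: "Suc k < m" using k by simp
      have "b = shuffle d a"
        using ab False
        by (auto simp: RA entry split: if_splits)
      then have "b = \<rho> (Suc k)" using next_neq[OF Sk] k by simp
      then show ?thesis using H\<rho> Sk k by simp
    qed (use ab in \<open>auto simp: RA split: if_splits\<close>)
  qed (use A in simp)
  then have "cofactor ?A r r = 1" using det_replace_row[OF A r r] by simp
  then show ?thesis using cofactor_alex_mat[of d r r "1 :: int"] d r m by (simp add: shape_def)
qed

lemma T_power: "T ^ j = monom 1 j"
  by (simp add: monom_altdef)

lemma coeff_T_term: "coeff ((1 - T) * T ^ j) n = (if n = j then 1 else 0) - (if n = Suc j then 1 else 0)"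
proof -
  have "(1 - T) * T ^ j = T ^ j - T ^ Suc j" by (simp add: algebra_simps)
  then show ?thesis by (simp add: T_power del: power_Suc)
qed

lemma degree_T_term: "degree ((1 - T) * T ^ j) \<le> Suc j"
  by (rule degree_le) (simp only: coeff_T_term, simp)

text \<open>In row \<open>length d - 1\<close> and the last column the cofactor is \<open>T ^ (length d - 1)\<close> times the Alexander
  polynomial. Bounding the degree of its over rows by \<open>d ! i\<close> and of its under rows by \<open>0\<close>,
  the matrix of leading coefficients has, up to sign, determinant 1, because the potential
  \<open>H\<close> below leaves the permutation \<open>shuffle d\<close> as the only one in the Leibniz formula.\<close>

lemma degree_alex:
  assumes d: "shape d"
  shows "degree (alex T d) = (\<Sum>i<length d - 1. d ! i - 1)"
proof -
  define m where "m = strands d"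
  define p where "p = length d"
  have sd: "sorted d" and d0: "d \<noteq> []" using d by (auto simp: shape_def)
  have p: "0 < p" using d0 by (simp add: p_def)
  have "1 \<le> last d" using last_in_set[OF d0] d by (simp add: shape_def)
  then have pm: "p < m" by (simp add: m_def p_def strands_def)
  have d1: "1 \<le> d ! i" if "i < p" for i using d that by (simp add: shape_def p_def)
  let ?A = "alex_mat T d"
  have A: "?A \<in> carrier_mat m m" unfolding m_def by (rule alex_mat_carrier)
  note RA = replace_row_alex_mat[of _ d, folded m_def]
  let ?M = "replace_row ?A (p - 1) (m - 1)"
  have M: "?M \<in> carrier_mat m m" using A by simp
  \<comment> \<open>Row \<open>p - 1\<close> has become a unit row and gets the bound 0; this keeps
    the last displacement out of the degree.\<close>
  define r where "r = (\<lambda>i. if i < p - 1 then d ! i else 0)"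
  have Mdet: "det ?M = T ^ (p - 1) * alex T d"
    using det_replace_row[OF A, of "p - 1" "m - 1"] cofactor_alex_mat[of d "p - 1" "m - 1" T] d0 sd p pm
    by (simp add: m_def)
  have deg: "degree (?M $$ (i, j)) \<le> r i" if ij: "i < m" "j < m" for i j
  proof (cases "i < p - 1")
    case True
    have "degree (burau_entry T d i j) \<le> d ! i"
    proof -
      have "degree (\<Sum>l<d ! i. if j = shuffle d (length d + l) then (1 - T) * T ^ l else 0) \<le> d ! i"
        by (rule degree_sum_le) (auto intro: order_trans[OF degree_T_term])
      moreover have "degree (if j = shuffle d i then T ^ (d ! i) else 0) \<le> d ! i"
        by (simp add: T_power degree_monom_le)
      ultimately show ?thesis
        using True by (auto simp: burau_entry_def p_def intro: degree_add_le)
    qed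
    then show ?thesis
      using True ij
      by (auto simp: RA r_def intro!: degree_diff_le)
  next
    case False
    then show ?thesis
      using ij
      by (auto simp: RA r_def burau_entry_def p_def
        intro!: degree_diff_le)
  qed
  let ?C = "mat m m (\<lambda>(i, j). coeff (?M $$ (i, j)) (r i))"
  define \<pi> where "\<pi> = (\<lambda>i. if i < m then shuffle d i else i)"
  have bij: "bij_betw (shuffle d) {..<m} {..<m}" unfolding m_def by (rule shuffle_bij[OF d0 sd])
  have \<pi>: "\<pi> permutes {0..<m}"
  proof (rule bij_imp_permutes)
    show "bij_betw \<pi> {0..<m} {0..<m}"
      using bij unfolding atLeast0LessThan by (rule bij_betw_cong[THEN iffD1, rotated]) (simp add: \<pi>_def)
  qed (simp add: \<pi>_def)
  have inj: "shuffle d a = shuffle d b \<longleftrightarrow> a = b" for a b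
    using shuffle_inj[OF sd] by (simp add: inj_eq)
  \<comment> \<open>Column \<open>m - 1\<close> was chosen because the last over strand ends there,
    so the 1 of the replaced row lies on the permutation \<open>shuffle d\<close>.\<close>
  have top: "shuffle d (p - 1) = m - 1"
  proof -
    have "shuffle d (p - 1) = (p - 1) + d ! (p - 1)" using p by (simp add: shuffle_over p_def)
    also have "d ! (p - 1) = last d" using last_conv_nth[OF d0] by (simp add: p_def)
    finally show ?thesis using p unfolding m_def strands_def p_def by linarith
  qed
  \<comment> \<open>Two terms of an over row reach degree \<open>d ! i\<close>: staying on top, and
    the drop at the last crossing \<open>j = d ! i - 1\<close>, whose leading coefficient is -1.
    Subtracting the row from the identity reverses both signs.\<close>
  have C1: "?C $$ (i, shuffle d b) = (if b = p + (d ! i - 1) then 1 else 0) - (if b = i then 1 else 0)"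
    if "i < p - 1" "b < m" for i b
  proof -
    have im: "i < m" "i < length d" using that pm by (auto simp: p_def)
    have bm: "shuffle d b < m" using bij that by (auto simp: bij_betw_def)
    obtain e where e: "d ! i = Suc e" using d1[of i] im by (cases "d ! i") (auto simp: p_def)
    have "coeff (burau_entry T d i (shuffle d b)) (d ! i) =
       (if b = i then 1 else 0) + (\<Sum>l<d ! i. if b = p + l then coeff ((1 - T) * T ^ l) (d ! i) else 0)"
      using im
      by (auto simp: burau_entry_def coeff_sum inj p_def T_power if_distrib[of "\<lambda>f. coeff f _"] cong: if_cong)
    also have "(\<Sum>l<d ! i. if b = p + l then coeff ((1 - T) * T ^ l) (d ! i) else 0) =
       (\<Sum>l<d ! i. if l = e then (if b = p + e then - 1 else 0) else 0)"
      by (rule sum.cong) (auto simp only: coeff_T_term e, auto)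
    also have "\<dots> = (if b = p + e then - 1 else 0)" by (simp add: e)
    finally have "coeff (burau_entry T d i (shuffle d b)) (d ! i) =
      (if b = i then 1 else 0) + (if b = p + e then - 1 else 0)" .
    then show ?thesis
      using that im bm by (auto simp: RA r_def e)
  qed
  have C2: "?C $$ (i, shuffle d b) = (if i = shuffle d b then 1 else 0) - (if b = i then 1 else 0)"
    if "p \<le> i" "i < m" "b < m" for i b
  proof -
    have bm: "shuffle d b < m" using bij that by (auto simp: bij_betw_def)
    have "i \<noteq> p - 1" "\<not> i < p - 1" "\<not> i < length d"
      using that(1) p unfolding p_def by linarith+
    then show ?thesis
      using that(2) bm by (auto simp: RA r_def burau_entry_def inj)
  qed
  have C3: "?C $$ (p - 1, shuffle d b) = (if b = p - 1 then 1 else 0)" if "b < m" for b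
  proof -
    have bm: "shuffle d b < m" using bij that by (auto simp: bij_betw_def)
    have "p - 1 < m" "shuffle d b = m - 1 \<longleftrightarrow> b = p - 1" using pm top inj[of b "p - 1"] by auto
    then show ?thesis using bm by (simp add: RA r_def)
  qed
  \<comment> \<open>Over strands are placed at their ends, under strands at their starts. An under
    strand is followed by the strand ending at its start; doubling and subtracting 1 puts it just
    below an over strand that ends there. The step from an over strand to its last crossed under
    strand still increases since \<open>a < p - 1\<close>.\<close>
  define H where "H = (\<lambda>a. if a < p then 2 * (a + d ! a) else 2 * a - 1)"
  have under: "shuffle d a < a" if "p \<le> a" "a < m" for a
    using shuffle_under_less[OF d] that by (simp add: p_def m_def)
  have pot: "a = b \<or> H a < H b" if ab: "a < m" "b < m" "?C $$ (a, \<pi> b) \<noteq> 0" for a b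
  proof -
    consider "a < p - 1" | "a = p - 1" | "p \<le> a" by linarith
    then show ?thesis
    proof cases
      case 1
      then have "b = p + (d ! a - 1) \<or> b = a"
        using C1[of a b] ab by (auto simp: \<pi>_def split: if_splits)
      moreover have "1 \<le> d ! a" using 1 by (intro d1) simp
      then have "a < p" "\<not> p + (d ! a - 1) < p" "2 * (a + d ! a) < 2 * (p + (d ! a - 1)) - 1"
      proof -
        obtain x where x: "d ! a = Suc x" using \<open>1 \<le> d ! a\<close> by (cases "d ! a") auto
        obtain y where y: "p = a + 2 + y" using 1 le_Suc_ex[of "a + 2" p] by fastforce
        show "a < p" "\<not> p + (d ! a - 1) < p" "2 * (a + d ! a) < 2 * (p + (d ! a - 1)) - 1"
          unfolding x y by simp_all
      qed
      then have "H a < H (p + (d ! a - 1))" by (simp only: H_def if_True if_False)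
      ultimately show ?thesis by auto
    next
      case 2
      then show ?thesis using C3[of b] ab by (auto simp: \<pi>_def split: if_splits)
    next
      case 3
      then have "a = shuffle d b \<or> b = a"
        using C2[of a b] ab by (auto simp: \<pi>_def split: if_splits)
      moreover have "H a < H b" if "a = shuffle d b"
      proof (cases "b < p")
        case True
        then show ?thesis using 3 p that by (simp add: H_def shuffle_over p_def)
      next
        case False
        then have "a < b" using under[of b] that ab by simp
        then show ?thesis using 3 False p by (simp add: H_def)
      qed
      ultimately show ?thesis by auto
    qed
  qed
  have "det ?C = signof \<pi> * (\<Prod>a = 0..<m. ?C $$ (a, \<pi> a))"
    by (rule det_single_permutation[OF _ \<pi> pot]) simp
  moreover have "?C $$ (a, \<pi> a) \<noteq> 0" if "a < m" for a
  proof -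
    consider "a < p - 1" | "a = p - 1" | "p \<le> a" by linarith
    then show ?thesis
    proof cases
      case 1
      then show ?thesis using C1[of a a] that by (simp add: \<pi>_def)
    next
      case 2
      then show ?thesis using C3[of a] that by (simp add: \<pi>_def)
    next
      case 3
      then show ?thesis using C2[of a a] under[of a] that by (simp add: \<pi>_def)
    qed
  qed
  ultimately have "det ?C \<noteq> 0" by (simp add: sign_def)
  then have "coeff (det ?M) (\<Sum>i = 0..<m. r i) \<noteq> 0"
    using coeff_det_sum[OF M deg] by simp
  then have "(\<Sum>i = 0..<m. r i) \<le> degree (det ?M)" and nz: "det ?M \<noteq> 0"
    by (auto intro: le_degree)
  then have "degree (det ?M) = (\<Sum>i = 0..<m. r i)"
    using degree_det_le_sum[OF M deg] by simp
  \<comment> \<open>The factor \<open>T ^ (p - 1)\<close> takes 1 off each of the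
    \<open>p - 1\<close> displacements.\<close>
  moreover have "degree (det ?M) = (p - 1) + degree (alex T d)"
    using nz unfolding Mdet by (simp add: degree_mult_eq T_power degree_monom_eq)
  moreover have "(\<Sum>i = 0..<m. r i) = (\<Sum>i<p - 1. d ! i)"
    unfolding r_def atLeast0LessThan
    by (rule sum.mono_neutral_cong_right) (use pm in auto)
  moreover have "(\<Sum>i<p - 1. d ! i) = (\<Sum>i<p - 1. d ! i - 1) + (p - 1)"
  proof -
    have "(\<Sum>i<p - 1. d ! i) = (\<Sum>i<p - 1. (d ! i - 1) + 1)"
    proof (rule sum.cong)
      fix i assume "i \<in> {..<p - 1}"
      then have "i < p" by simp
      then show "d ! i = d ! i - 1 + 1" using d1[of i] by simp
    qed simp
    then show ?thesis unfolding sum.distrib by simp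
  qed
  ultimately show ?thesis by (simp add: p_def)
qed

section \<open>Reduction to partitions\<close>

lemma alex_replicate_1:
  fixes t :: "'a :: idom"
  assumes "shape d" "t \<noteq> 0"
  shows "alex t (replicate k (Suc 0) @ d) = alex t d"
proof -
  have "shape (replicate k (Suc 0) @ d) \<and> alex t (replicate k (Suc 0) @ d) = alex t d"
    using assms by (induction k) (auto simp: alex_Cons_1 shape_Cons_1)
  then show ?thesis ..
qed

lemma alex_snoc_add:
  fixes t :: "'a :: idom"
  assumes "shape (c @ [q])"
  shows "alex t (c @ [q + k]) = alex t (c @ [q])"
proof (induction k)
  case (Suc k)
  have "shape (c @ [q + k])" using assms by (auto simp: shape_def sorted_append trans_le_add1)
  then show ?case using Suc alex_snoc_Suc[of c "q + k" t] by simp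
qed simp

lemma sorted_split_1:
  fixes b :: "nat list"
  assumes "sorted b" "\<forall>x\<in>set b. 1 \<le> x"
  shows "b = replicate (length (filter (\<lambda>x. x = 1) b)) 1 @ filter (\<lambda>x. x \<noteq> 1) b"
  using assms
proof (induction b)
  case (Cons a b)
  show ?case
  proof (cases "a = 1")
    case False
    then have "\<forall>x\<in>set b. x \<noteq> 1" using Cons.prems by auto
    then show ?thesis using False by (simp add: filter_id_conv[THEN iffD2] filter_False)
  qed (use Cons in auto)
qed simp

text \<open>The last displacement is dropped: it only records the number of under strands.\<close>

definition core :: "nat list \<Rightarrow> nat multiset" where
  "core d = filter_mset (\<lambda>x. 0 < x) (mset (map (\<lambda>x. x - 1) (butlast d)))"

text \<open>The final displacement is the smallest one that keeps the list sorted. For the empty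
  multiset \<open>last c\<close> is unspecified, so this is applied to nonempty cores.\<close>

definition canonical_shape :: "nat multiset \<Rightarrow> nat list" where
  "canonical_shape M = (let c = map Suc (sorted_list_of_multiset M) in c @ [last c])"

lemma sum_mset_core:
  "sum_mset (core d) = (\<Sum>i<length d - 1. d ! i - 1)"
proof -
  have "sum_mset (filter_mset (\<lambda>x. 0 < x) N) = sum_mset N" for N :: "nat multiset"
    by (induction N) auto
  then have "sum_mset (core d) = sum_list (map (\<lambda>x. x - 1) (butlast d))"
    by (simp add: core_def sum_mset_sum_list del: mset_map)
  also have "\<dots> = (\<Sum>i<length d - 1. d ! i - 1)"
    by (simp add: sum_list_sum_nth atLeast0LessThan nth_butlast)
  finally show ?thesis .
qed

lemma alex_canonical_shape:
  fixes t :: "'a :: idom"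
  assumes d: "shape d" and ne: "core d \<noteq> {#}" and t: "t \<noteq> 0"
  shows "alex t d = alex t (canonical_shape (core d))"
proof -
  obtain b q where bq: "d = b @ [q]" using d by (cases d rule: rev_cases) (auto simp: shape_def)
  define c where "c = filter (\<lambda>x. x \<noteq> 1) b"
  have b: "sorted b" "\<forall>x\<in>set b. 1 \<le> x" "\<forall>x\<in>set b. x \<le> q" "1 \<le> q"
    using d by (auto simp: bq shape_def sorted_append)
  have c: "sorted c" "\<forall>x\<in>set c. 2 \<le> x" "\<forall>x\<in>set c. x \<le> q"
    using b by (auto simp: c_def sorted_wrt_filter le_neq_implies_less Suc_le_eq numeral_2_eq_2)
  have "core d = mset (map (\<lambda>x. x - 1) c)"
  proof -
    have "filter (\<lambda>x. 0 < x) (map (\<lambda>x. x - 1) b) = map (\<lambda>x. x - 1) c"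
      unfolding c_def filter_map using b(2)
      by (intro arg_cong[where f = "map _"] filter_cong) (auto simp: le_eq_less_or_eq)
    then show ?thesis by (simp add: core_def bq mset_filter[symmetric] del: mset_filter mset_map)
  qed
  moreover have "sorted (map (\<lambda>x. x - 1) c)"
    using c(1) by (auto simp: sorted_map intro: sorted_wrt_mono_rel[rotated])
  ultimately have "sorted_list_of_multiset (core d) = map (\<lambda>x. x - 1) c"
    by (simp add: sorted_sort_id del: mset_map)
  moreover have "map Suc (map (\<lambda>x. x - 1) c) = c"
    using c(2) by (auto intro!: map_idI)
  ultimately have canon: "canonical_shape (core d) = c @ [last c]"
    by (simp add: canonical_shape_def del: map_map)
  have c0: "c \<noteq> []" using ne \<open>core d = _\<close> by auto
  have lc: "last c \<le> q" using c(3) c0 by simp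
  have "alex t d = alex t (replicate (length (filter (\<lambda>x. x = 1) b)) (Suc 0) @ c @ [q])"
    using arg_cong[OF sorted_split_1[OF b(1,2)], of "\<lambda>b. b @ [q]"] unfolding bq c_def
    by (simp only: append_assoc One_nat_def)
  also have "\<dots> = alex t (c @ [q])"
    using c b(4) t by (intro alex_replicate_1) (auto simp: shape_def sorted_append)
  also have "\<dots> = alex t (c @ [last c + (q - last c)])" using lc by simp
  also have "\<dots> = alex t (c @ [last c])"
  proof (rule alex_snoc_add)
    have "\<forall>x\<in>set c. x \<le> last c"
      using sorted_le_last[OF c(1)] by (auto simp: in_set_conv_nth)
    moreover have "2 \<le> last c" using c(2) last_in_set[OF c0] by blast
    ultimately show "shape (c @ [last c])"
      using c(1,2) by (auto simp: shape_def sorted_append)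
  qed
  finally show ?thesis by (simp add: canon)
qed

text \<open>The value at 1 fixes the sign and a nonzero value at 0 excludes a positive power of the
  variable, so the description has a unique solution.\<close>

lemma alex_normalize_id:
  assumes "poly f 0 = 1" "poly f 1 = 1"
  shows "alex_normalize f = f"
  unfolding alex_normalize_def
proof (rule the_equality)
  show "poly f 0 \<noteq> 0 \<and> poly f 1 = 1 \<and> (\<exists>k u. (u = 1 \<or> u = - 1) \<and> smult u f = monom 1 k * f)"
    using assms by (intro conjI exI[of _ "0 :: nat"] exI[of _ "1 :: int"]) auto
next
  fix p assume p: "poly p 0 \<noteq> 0 \<and> poly p 1 = 1 \<and>
    (\<exists>k u. (u = 1 \<or> u = - 1) \<and> smult u f = monom 1 k * p)"
  then obtain k u where ku: "smult u f = monom 1 k * p" by blast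
  have u: "u = 1"
    using arg_cong[OF ku, of "\<lambda>g. poly g 1"] assms(2) p by (simp add: poly_monom)
  then have "k = 0"
    using arg_cong[OF ku, of "\<lambda>g. poly g 0"] assms(1) by (cases k) (auto simp: poly_monom)
  with ku u show "p = f" by (simp add: monom_0)
qed

text \<open>Since \<open>card\<close> is 0 on infinite sets, the bound needs finiteness. Positive
  parts with sum \<open>n\<close> are at most \<open>n\<close> in number and in size.\<close>

lemma finite_partitions: "finite {M :: nat multiset. (\<forall>x\<in>#M. x > 0) \<and> sum_mset M = n}"
proof (rule finite_subset)
  show "{M :: nat multiset. (\<forall>x\<in>#M. x > 0) \<and> sum_mset M = n} \<subseteq>
    mset ` {xs. set xs \<subseteq> {..n} \<and> length xs \<le> n}"
  proof
    fix M :: "nat multiset"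
    assume "M \<in> {M. (\<forall>x\<in>#M. x > 0) \<and> sum_mset M = n}"
    then have M: "\<forall>x\<in>#M. x > 0" "sum_mset M = n" by auto
    obtain xs where xs: "mset xs = M" using ex_mset by blast
    have "size M \<le> sum_mset M" using M(1) by (induction M) (auto simp: Suc_le_eq add_le_mono)
    moreover have "x \<le> n" if "x \<in># M" for x
      using that M(2) by (metis sum_mset.remove le_add1)
    ultimately show "M \<in> mset ` {xs. set xs \<subseteq> {..n} \<and> length xs \<le> n}"
      using xs M(2) by (intro image_eqI[of _ _ xs]) auto
  qed
  show "finite (mset ` {xs :: nat list. set xs \<subseteq> {..n} \<and> length xs \<le> n})"
    by (intro finite_imageI finite_lists_length_le) simp
qed

section \<open>Bubble sort\<close>

text \<open>\<open>S\<close> is the set of bottom points of the over strands. Every list met while sorting a Lorenz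
  permutation satisfies the predicate below, and the Burau matrix of what remains to be sorted
  is then given in closed form by \<open>layered_entry\<close>.\<close>

definition layered :: "nat set \<Rightarrow> nat list \<Rightarrow> bool" where
  "layered S xs \<longleftrightarrow>
     (\<forall>i k. i < k \<and> k < length xs \<and> xs ! k < xs ! i \<longrightarrow> xs ! i \<in> S \<and> xs ! k \<notin> S)"

definition later_less :: "nat list \<Rightarrow> nat \<Rightarrow> nat \<Rightarrow> nat" where
  "later_less xs i v = card {l. i < l \<and> l < length xs \<and> xs ! l < v}"

text \<open>Rows are current positions, columns are bottom points. A walker on an over strand meets
  the smaller labels to its right in increasing order, so \<open>later_less xs i k\<close> is the
  number of crossings it has survived before meeting label \<open>k\<close>.\<close>

definition layered_entry :: "nat set \<Rightarrow> nat list \<Rightarrow> nat \<Rightarrow> nat \<Rightarrow> int poly" where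
  "layered_entry S xs i k =
    (if xs ! i \<in> S
     then (if k = xs ! i then [:0, 1:] ^ later_less xs i k
           else if k < xs ! i \<and> (\<exists>l. i < l \<and> l < length xs \<and> xs ! l = k)
           then (1 - [:0, 1:]) * [:0, 1:] ^ later_less xs i k else 0)
     else (if k = xs ! i then 1 else 0))"

text \<open>A measure for the fuel of \<open>bubble_word\<close>: each swap moves one over strand
  one place to the right and lowers it by exactly 1.\<close>

definition mass :: "nat set \<Rightarrow> nat list \<Rightarrow> nat" where
  "mass S xs = (\<Sum>i<length xs. if xs ! i \<in> S then length xs - i else 0)"

lemma burau_gen_carrier [simp]: "burau_gen m i \<in> carrier_mat m m"
  by (simp add: burau_gen_def)

text \<open>Pulling out the accumulator lets a word be peeled from its first letter, as the
  recursion of \<open>bubble_word\<close> requires, although \<open>foldl\<close> appends factors on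
  the right.\<close>

lemma burau_foldl:
  "A \<in> carrier_mat m m \<Longrightarrow>
   foldl (\<lambda>A i. A * burau_gen m i) A w = A * burau m w \<and> burau m w \<in> carrier_mat m m"
proof (induction w arbitrary: A)
  case (Cons i w)
  have 1: "burau m (i # w) = burau_gen m i * burau m w \<and> burau m w \<in> carrier_mat m m"
    using Cons.IH[of "burau_gen m i"] left_mult_one_mat[OF burau_gen_carrier[of m i]]
    by (simp add: burau_def)
  have "foldl (\<lambda>A i. A * burau_gen m i) A (i # w) = (A * burau_gen m i) * burau m w"
    using Cons.IH[of "A * burau_gen m i"] Cons.prems by simp
  also have "\<dots> = A * (burau_gen m i * burau m w)"
    using Cons.prems 1 by (intro assoc_mult_mat[of _ m m _ m _ m]) auto
  finally show ?case using 1 mult_carrier_mat[of "burau_gen m i" m m "burau m w" m] by simp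
qed (auto simp: burau_def)

lemma burau_Cons: "burau m (i # w) = burau_gen m i * burau m w"
  using burau_foldl[of "burau_gen m i" m w] left_mult_one_mat[OF burau_gen_carrier[of m i]]
  by (simp add: burau_def)

lemma burau_gen_mult_index:
  assumes B: "B \<in> carrier_mat m m" and i0: "Suc i0 < m" and i: "i < m" "k < m"
  shows "(burau_gen m i0 * B) $$ (i, k) =
    (if i = i0 then (1 - [:0, 1:]) * B $$ (i0, k) + [:0, 1:] * B $$ (Suc i0, k)
     else if i = Suc i0 then B $$ (i0, k) else B $$ (i, k))"
proof -
  have one_minus: "[:1, - 1:] = 1 - [:0, 1 :: int:]" unfolding one_pCons by simp
  have 0: "(burau_gen m i0 * B) $$ (i, k) = (\<Sum>l<m. burau_gen m i0 $$ (i, l) * B $$ (l, k))"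
    using B i by (simp add: scalar_prod_def atLeast0LessThan burau_gen_def)
  consider "i = i0" | "i = Suc i0" | "i \<noteq> i0" "i \<noteq> Suc i0" by blast
  then show ?thesis
  proof cases
    case 1
    have "(\<Sum>l<m. burau_gen m i0 $$ (i, l) * B $$ (l, k)) =
      (\<Sum>l<m. (if l = i0 then (1 - [:0, 1:]) * B $$ (i0, k) else 0) +
             (if l = Suc i0 then [:0, 1:] * B $$ (Suc i0, k) else 0))"
      using 1 i by (intro sum.cong) (auto simp: burau_gen_def one_minus)
    then show ?thesis using 0 1 i0 by (simp add: sum.distrib)
  next
    case 2
    have "(\<Sum>l<m. burau_gen m i0 $$ (i, l) * B $$ (l, k)) = (\<Sum>l<m. if l = i0 then B $$ (i0, k) else 0)"
      using 2 i by (intro sum.cong) (auto simp: burau_gen_def)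
    then show ?thesis using 0 2 i0 by simp
  next
    case 3
    have "(\<Sum>l<m. burau_gen m i0 $$ (i, l) * B $$ (l, k)) = (\<Sum>l<m. if l = i then B $$ (i, k) else 0)"
      using 3 i by (intro sum.cong) (auto simp: burau_gen_def)
    then show ?thesis using 0 3 i by simp
  qed
qed

lemma swap_adj_nth:
  assumes "Suc i0 < length xs" "i < length xs"
  shows "swap_adj xs i0 ! i = xs ! transpose i0 (Suc i0) i"
  using assms by (auto simp: swap_adj_def nth_list_update transpose_def)

lemma length_swap_adj [simp]: "length (swap_adj xs i) = length xs"
  by (simp add: swap_adj_def)

lemma layered_swap_adj:
  assumes lay: "layered S xs" and i0: "Suc i0 < length xs" "xs ! Suc i0 < xs ! i0"
  shows "layered S (swap_adj xs i0)"
  unfolding layered_def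
proof (intro allI impI, elim conjE)
  fix i k assume ik: "i < k" "k < length (swap_adj xs i0)" "swap_adj xs i0 ! k < swap_adj xs i0 ! i"
  let ?t = "transpose i0 (Suc i0)"
  have n: "swap_adj xs i0 ! i = xs ! ?t i" "swap_adj xs i0 ! k = xs ! ?t k"
    using ik i0 by (simp_all add: swap_adj_nth)
  have "\<not> (i = i0 \<and> k = Suc i0)" using ik(3) i0 unfolding n by auto
  then have "?t i < ?t k" "?t k < length xs" using ik i0 by (auto simp: transpose_def)
  then show "swap_adj xs i0 ! i \<in> S \<and> swap_adj xs i0 ! k \<notin> S"
    using lay ik(3) unfolding n layered_def by blast
qed

lemma mass_swap_adj:
  assumes lay: "layered S xs" and i0: "Suc i0 < length xs" "xs ! Suc i0 < xs ! i0"
  shows "mass S xs = Suc (mass S (swap_adj xs i0))"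
proof -
  let ?t = "transpose i0 (Suc i0)" and ?m = "length xs"
  have S: "xs ! i0 \<in> S" "xs ! Suc i0 \<notin> S" using lay i0 by (auto simp: layered_def)
  have bij: "bij_betw ?t {..<?m} {..<?m}"
    using i0 by (intro bij_betwI[of _ _ _ ?t]) (auto simp: transpose_def)
  have "mass S (swap_adj xs i0) = (\<Sum>i<?m. if xs ! ?t i \<in> S then ?m - i else 0)"
    using i0 by (auto simp: mass_def swap_adj_nth intro!: sum.cong)
  also have "\<dots> = (\<Sum>i<?m. if xs ! i \<in> S then ?m - ?t i else 0)"
    using sum.reindex_bij_betw[OF bij, of "\<lambda>i. if xs ! i \<in> S then ?m - ?t i else 0"]
    by (simp cong: if_cong)
  finally have "Suc (mass S (swap_adj xs i0)) = Suc (\<Sum>i<?m. if xs ! i \<in> S then ?m - ?t i else 0)"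
    by simp
  also have "\<dots> = (\<Sum>i<?m. if i = i0 then 1 else 0) + (\<Sum>i<?m. if xs ! i \<in> S then ?m - ?t i else 0)"
    using i0 by simp
  also have "\<dots> = mass S xs"
    unfolding mass_def sum.distrib[symmetric]
    by (rule sum.cong) (use S i0 in \<open>auto simp: transpose_def\<close>)
  finally show ?thesis by simp
qed

text \<open>Unless \<open>i = i0\<close>, either both swapped positions lie to the right of
  \<open>i\<close> or neither does, so the swap permutes the positions that are counted.\<close>

lemma later_less_swap_adj:
  assumes i0: "Suc i0 < length xs" and i: "i < i0 \<or> Suc i0 \<le> i"
  shows "later_less (swap_adj xs i0) i v = later_less xs i v"
    and "(\<exists>l. i < l \<and> l < length xs \<and> swap_adj xs i0 ! l = k) \<longleftrightarrow>
         (\<exists>l. i < l \<and> l < length xs \<and> xs ! l = k)"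
proof -
  let ?t = "transpose i0 (Suc i0)"
  have t: "i < ?t l \<and> ?t l < length xs \<longleftrightarrow> i < l \<and> l < length xs" for l
    using i i0 by (auto simp: transpose_def)
  have "{l. i < l \<and> l < length xs \<and> swap_adj xs i0 ! l < v} =
      ?t ` {l. i < l \<and> l < length xs \<and> xs ! l < v}"
  proof (rule equalityI; rule subsetI)
    fix l assume "l \<in> {l. i < l \<and> l < length xs \<and> swap_adj xs i0 ! l < v}"
    then show "l \<in> ?t ` {l. i < l \<and> l < length xs \<and> xs ! l < v}"
      using t[of l] i0 by (intro image_eqI[of _ _ "?t l"]) (auto simp: swap_adj_nth)
  next
    fix l assume "l \<in> ?t ` {l. i < l \<and> l < length xs \<and> xs ! l < v}"
    then obtain l' where l': "l = ?t l'" "i < l'" "l' < length xs" "xs ! l' < v" by blast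
    then show "l \<in> {l. i < l \<and> l < length xs \<and> swap_adj xs i0 ! l < v}"
      using t[of l'] i0 by (auto simp: swap_adj_nth)
  qed
  then show "later_less (swap_adj xs i0) i v = later_less xs i v"
    by (simp add: later_less_def card_image[OF inj_on_subset[OF inj_transpose subset_UNIV]])
  show "(\<exists>l. i < l \<and> l < length xs \<and> swap_adj xs i0 ! l = k) \<longleftrightarrow>
         (\<exists>l. i < l \<and> l < length xs \<and> xs ! l = k)"
  proof (safe, goal_cases)
    case (1 l)
    then show ?case using t[of l] i0 by (intro exI[of _ "?t l"]) (simp add: swap_adj_nth)
  next
    case (2 l)
    then show ?case using t[of l] i0 by (intro exI[of _ "?t l"]) (simp add: swap_adj_nth)
  qed
qed

lemma later_less_Suc:
  assumes "Suc i < length xs"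
  shows "later_less xs i v = later_less xs (Suc i) v + (if xs ! Suc i < v then 1 else 0)"
proof -
  have iff: "i < l \<longleftrightarrow> l = Suc i \<or> Suc i < l" for l by linarith
  have "{l. i < l \<and> l < length xs \<and> xs ! l < v} =
    {l. Suc i < l \<and> l < length xs \<and> xs ! l < v} \<union> (if xs ! Suc i < v then {Suc i} else {})"
    using assms by (auto simp: iff)
  then show ?thesis by (auto simp: later_less_def)
qed

text \<open>One step of the walk. At the first crossing the over walker drops onto label
  \<open>u\<close> with weight \<open>1 - t\<close> and stays there, or continues with weight
  \<open>t\<close> and has one crossing fewer ahead; the factor \<open>t\<close> makes up for the
  decrease of \<open>later_less\<close>.\<close>

lemma layered_entry_swap_adj:
  assumes lay: "layered S xs" and dist: "distinct xs"
    and i0: "Suc i0 < length xs" "xs ! Suc i0 < xs ! i0" and i: "i < length xs"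
  defines "ys \<equiv> swap_adj xs i0"
  shows "layered_entry S xs i k =
    (if i = i0 then (1 - [:0, 1:]) * layered_entry S ys i0 k + [:0, 1:] * layered_entry S ys (Suc i0) k
     else if i = Suc i0 then layered_entry S ys i0 k else layered_entry S ys i k)"
proof -
  have S: "xs ! i0 \<in> S" "xs ! Suc i0 \<notin> S" using lay i0 by (auto simp: layered_def)
  have ys: "ys ! i0 = xs ! Suc i0" "ys ! Suc i0 = xs ! i0"
    using i0 by (simp_all add: ys_def swap_adj_nth)
  have len: "length ys = length xs" by (simp add: ys_def)
  consider "i = i0" | "i = Suc i0" | "i < i0 \<or> Suc (Suc i0) \<le> i" by linarith
  then show ?thesis
  proof cases
    case 1
    define u where "u = xs ! Suc i0"
    define v where "v = xs ! i0"
    have uv: "u < v" using i0 by (simp add: u_def v_def)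
    have row0: "layered_entry S ys i0 k = (if k = u then 1 else 0)"
      using S ys by (simp add: layered_entry_def u_def)
    define P0 where "P0 \<longleftrightarrow> (\<exists>l. i0 < l \<and> l < length xs \<and> xs ! l = k)"
    define P1 where "P1 \<longleftrightarrow> (\<exists>l. Suc i0 < l \<and> l < length xs \<and> xs ! l = k)"
    have row1: "layered_entry S ys (Suc i0) k =
      (if k = v then [:0, 1:] ^ later_less xs (Suc i0) k
       else if k < v \<and> P1 then (1 - [:0, 1:]) * [:0, 1:] ^ later_less xs (Suc i0) k else 0)"
      unfolding layered_entry_def ys(2) v_def[symmetric] len P1_def
      unfolding ys_def later_less_swap_adj[OF i0(1) disjI2[OF le_refl]]
      using S(1) by (simp only: v_def if_True)
    have row: "layered_entry S xs i0 k =
      (if k = v then [:0, 1:] ^ later_less xs i0 k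
       else if k < v \<and> P0 then (1 - [:0, 1:]) * [:0, 1:] ^ later_less xs i0 k else 0)"
      unfolding layered_entry_def v_def[symmetric] P0_def
      using S(1) by (simp only: v_def if_True)
    note step = later_less_Suc[OF i0(1), of k, folded u_def]
    have P01: "P0 \<longleftrightarrow> P1 \<or> k = u"
    proof
      assume P0
      then obtain l where l: "i0 < l" "l < length xs" "xs ! l = k" by (auto simp: P0_def)
      show "P1 \<or> k = u"
      proof (cases "l = Suc i0")
        case False
        then have "Suc i0 < l" using l(1) by linarith
        then show ?thesis using l unfolding P1_def by blast
      qed (use l in \<open>simp add: u_def\<close>)
    next
      assume "P1 \<or> k = u"
      then show P0
      proof
        assume P1
        then obtain l where "Suc i0 < l" "l < length xs" "xs ! l = k" unfolding P1_def by blast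
        then show P0 unfolding P0_def by (intro exI[of _ l]) simp
      next
        assume "k = u"
        then show P0 unfolding P0_def u_def using i0(1) by (intro exI[of _ "Suc i0"]) simp
      qed
    qed
    \<comment> \<open>A smaller label further right would form an inversion with \<open>u\<close>
      and force \<open>u\<close> into \<open>S\<close>. So \<open>u\<close> is the least label
      ahead, and its exponent is 0.\<close>
    have below: "u \<le> xs ! l" if "Suc i0 < l" "l < length xs" for l
    proof (rule ccontr)
      assume "\<not> u \<le> xs ! l"
      then have "xs ! l < xs ! Suc i0" by (simp add: u_def)
      then show False using lay that S(2) unfolding layered_def by blast
    qed
    have P1u: "u < k" if P1
    proof -
      obtain l where l: "Suc i0 < l" "l < length xs" "xs ! l = k" using \<open>P1\<close> by (auto simp: P1_def)
      have "xs ! l \<noteq> u" using nth_eq_iff_index_eq[OF dist, of l "Suc i0"] l i0(1) by (auto simp: u_def)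
      then show ?thesis using below[OF l(1,2)] l(3) by simp
    qed
    have l0: "later_less xs i0 u = 0"
    proof -
      have "xs ! l \<ge> u" if "i0 < l" "l < length xs" for l
        using below[of l] that by (cases "l = Suc i0") (simp_all add: u_def)
      then have "{l. i0 < l \<and> l < length xs \<and> xs ! l < u} = {}" using leD by blast
      then show ?thesis unfolding later_less_def by simp
    qed
    have "layered_entry S xs i0 k =
      (1 - [:0, 1:]) * layered_entry S ys i0 k + [:0, 1:] * layered_entry S ys (Suc i0) k"
    proof (cases "k = u")
      case True
      then have "\<not> P1" using P1u by auto
      with True show ?thesis unfolding row row0 row1 using uv l0 P01 by simp
    next
      case False
      show ?thesis
      proof (cases "k = v")
        case True
        then show ?thesis unfolding row row0 row1 using uv step by simp
      next
        case kv: False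
        show ?thesis
        proof (cases "k < v \<and> P1")
          case True
          then show ?thesis unfolding row row0 row1 using False kv P01 P1u step by simp
        next
          case 3: False
          then have "\<not> (k < v \<and> P0)" using P01 False by blast
          with 3 show ?thesis unfolding row row0 row1 using False kv by (simp only: if_False mult_zero_right add_0_left)
        qed
      qed
    qed
    then show ?thesis unfolding 1 by simp
  next
    case 2
    then show ?thesis using S ys by (simp add: layered_entry_def)
  next
    case 3
    then have "ys ! i = xs ! i" using i0 i by (auto simp: ys_def swap_adj_nth transpose_def)
    moreover have "i < i0 \<or> Suc i0 \<le> i" using 3 by linarith
    ultimately have "layered_entry S ys i k = layered_entry S xs i k"
      unfolding layered_entry_def ys_def length_swap_adj
      by (simp only: later_less_swap_adj[OF i0(1)])
    then show ?thesis using 3 by auto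
  qed
qed

lemma has_inv_first_inv:
  assumes "has_inv xs"
  shows "Suc (first_inv xs) < length xs" "xs ! Suc (first_inv xs) < xs ! first_inv xs"
proof -
  have "Suc (first_inv xs) < length xs \<and> xs ! Suc (first_inv xs) < xs ! first_inv xs"
    unfolding first_inv_def using assms unfolding has_inv_def by (rule LeastI_ex)
  then show "Suc (first_inv xs) < length xs" "xs ! Suc (first_inv xs) < xs ! first_inv xs"
    by blast+
qed

lemma not_has_inv:
  assumes "\<not> has_inv xs" "distinct xs" "set xs = {..<m}"
  shows "xs = [0..<m]"
proof (rule sorted_distinct_set_unique)
  show "sorted xs"
    unfolding sorted_iff_nth_Suc
  proof (intro allI impI)
    fix i assume i: "Suc i < length xs"
    show "xs ! i \<le> xs ! Suc i"
    proof (rule leI, rule notI)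
      assume "xs ! Suc i < xs ! i"
      then have "has_inv xs" unfolding has_inv_def using i by blast
      then show False using assms(1) by blast
    qed
  qed
qed (use assms in \<open>simp_all add: lessThan_atLeast0\<close>)

lemma distinct_set_swap_adj:
  assumes "Suc i0 < length xs"
  shows "distinct (swap_adj xs i0) = distinct xs" "set (swap_adj xs i0) = set xs"
  using assms by (simp_all add: swap_adj_def)

lemma burau_sorted:
  assumes "\<not> has_inv xs" "distinct xs" "set xs = {..<m}"
  shows "burau m [] = mat m m (\<lambda>(i, k). layered_entry S xs i k)"
proof -
  have "layered_entry S [0..<m] i k = (if k = i then 1 else 0)" if "i < m" "k < m" for i k
  proof -
    have "{l. i < l \<and> l < length [0..<m] \<and> [0..<m] ! l < i} = {}" by auto
    then have "later_less [0..<m] i i = 0" by (simp only: later_less_def card.empty)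
    moreover have "\<not> (k < i \<and> (\<exists>l. i < l \<and> l < length [0..<m] \<and> [0..<m] ! l = k))" by auto
    moreover have "[0..<m] ! i = i" using that by simp
    ultimately show ?thesis
      unfolding layered_entry_def by (cases "k = i") (simp_all only: if_False if_True if_cancel power_0 refl)
  qed
  moreover have "burau m [] = 1\<^sub>m m" by (simp add: burau_def)
  ultimately show ?thesis
    unfolding not_has_inv[OF assms] by (intro eq_matI) auto
qed

lemma burau_bubble_word:
  assumes "layered S xs" "distinct xs" "set xs = {..<m}" "mass S xs \<le> f"
  shows "burau m (bubble_word f xs) = mat m m (\<lambda>(i, k). layered_entry S xs i k)"
  using assms
proof (induction f arbitrary: xs)
  case (0 xs)
  \<comment> \<open>An inversion would make the mass positive, so the list is sorted by the time the
    fuel is spent.\<close>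
  have "\<not> has_inv xs"
  proof
    assume inv: "has_inv xs"
    show False using mass_swap_adj[OF 0(1) has_inv_first_inv[OF inv]] 0 by simp
  qed
  then show ?case using burau_sorted[of xs m S] 0 by simp
next
  case (Suc f xs)
  show ?case
  proof (cases "has_inv xs")
    case True
    define i0 where "i0 = first_inv xs"
    note i0 = has_inv_first_inv[OF True, folded i0_def]
    have l: "length xs = m" using distinct_card[OF Suc.prems(2)] Suc.prems(3) by simp
    have IH: "burau m (bubble_word f (swap_adj xs i0)) =
        mat m m (\<lambda>(i, k). layered_entry S (swap_adj xs i0) i k)"
    proof (rule Suc.IH)
      show "layered S (swap_adj xs i0)" using layered_swap_adj[OF Suc.prems(1) i0] .
      show "mass S (swap_adj xs i0) \<le> f" using mass_swap_adj[OF Suc.prems(1) i0] Suc.prems(4) by simp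
    qed (use distinct_set_swap_adj[OF i0(1)] Suc.prems in auto)
    have "burau m (bubble_word (Suc f) xs) =
        burau_gen m i0 * mat m m (\<lambda>(i, k). layered_entry S (swap_adj xs i0) i k)"
      unfolding bubble_word.simps(2) if_P[OF True] burau_Cons i0_def[symmetric] IH ..
    also have "\<dots> = mat m m (\<lambda>(i, k). layered_entry S xs i k)" (is "?P = ?Q")
    proof (rule eq_matI)
      fix i k assume "i < dim_row ?Q" "k < dim_col ?Q"
      then have ik: "i < m" "k < m" by simp_all
      have "?P $$ (i, k) = layered_entry S xs i k"
      proof -
        let ?B = "mat m m (\<lambda>(i, k). layered_entry S (swap_adj xs i0) i k)"
        have B: "?B \<in> carrier_mat m m" by simp
        have Bn: "?B $$ (j, k) = layered_entry S (swap_adj xs i0) j k" if "j < m" for j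
          using that ik(2) by simp
        have "i0 < m" "Suc i0 < m" using i0(1) l by simp_all
        then show ?thesis
          unfolding burau_gen_mult_index[OF B \<open>Suc i0 < m\<close> ik]
            layered_entry_swap_adj[OF Suc.prems(1,2) i0 ik(1)[folded l]]
          by (simp only: Bn ik)
      qed
      then show "?P $$ (i, k) = ?Q $$ (i, k)" using ik by simp
    qed (auto simp: burau_gen_def)
    finally show ?thesis .
  qed (use burau_sorted[of xs m S] Suc.prems in simp)
qed

lemma mass_le: "mass S xs \<le> length xs * length xs"
proof -
  have "mass S xs \<le> (\<Sum>i<length xs. length xs)"
    unfolding mass_def by (rule sum_mono) auto
  then show ?thesis by simp
qed

section \<open>Lorenz permutations as input of the sorting process\<close>

lemma layered_shuffle:
  assumes "shape d"
  shows "layered (shuffle d ` {..<length d}) (map (shuffle d) [0..<strands d])"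
  unfolding layered_def
proof (intro allI impI, elim conjE)
  let ?xs = "map (shuffle d) [0..<strands d]"
  have sd: "sorted d" using assms by (simp add: shape_def)
  have mem: "shuffle d i \<in> shuffle d ` {..<length d} \<longleftrightarrow> i < length d" for i
    using shuffle_inj[OF sd] by (auto simp: inj_image_mem_iff)
  fix i k assume ik: "i < k" "k < length ?xs" "?xs ! k < ?xs ! i"
  then have less: "shuffle d k < shuffle d i" by simp
  have "i < length d"
  proof (rule ccontr)
    assume "\<not> i < length d"
    then have "shuffle d i < shuffle d k"
      using ik(1) overshoot_mono[OF diff_le_mono[of i k "length d"], of d] \<open>\<not> i < length d\<close>
      by (simp add: shuffle_def)
    with less show False by simp
  qed
  moreover have "\<not> k < length d"
  proof
    assume "k < length d"
    then have "shuffle d i < shuffle d k"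
      using ik(1) sorted_nth_mono[OF sd, of i k] by (simp add: shuffle_over)
    with less show False by simp
  qed
  ultimately show "?xs ! i \<in> shuffle d ` {..<length d} \<and> ?xs ! k \<notin> shuffle d ` {..<length d}"
    using ik by (simp add: mem)
qed

text \<open>Over strands to the right of \<open>i\<close> end further right, so only under strands
  enter the count, and these keep their order: the exponent is \<open>d ! i\<close> at the walker's
  own end and \<open>j\<close> at the \<open>j\<close>-th under strand.\<close>

lemma layered_entry_shuffle:
  assumes d: "shape d" and i: "i < strands d" and k: "k < strands d"
  shows "layered_entry (shuffle d ` {..<length d}) (map (shuffle d) [0..<strands d]) i k =
    burau_entry T d i k"
proof -
  let ?xs = "map (shuffle d) [0..<strands d]" and ?p = "length d" and ?m = "strands d"
  have sd: "sorted d" "d \<noteq> []" using d by (auto simp: shape_def)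
  have inj: "shuffle d a = shuffle d b \<longleftrightarrow> a = b" for a b
    using shuffle_inj[OF sd(1)] by (simp add: inj_eq)
  have mem: "shuffle d i \<in> shuffle d ` {..<?p} \<longleftrightarrow> i < ?p" for i
    using shuffle_inj[OF sd(1)] by (auto simp: inj_image_mem_iff)
  have xi: "?xs ! i = shuffle d i" using i by simp
  have ll: "later_less ?xs i v = card {l. i < l \<and> l < ?m \<and> shuffle d l < v}" for v
    unfolding later_less_def by (rule arg_cong[where f = card]) auto
  have ex: "(\<exists>l. i < l \<and> l < length ?xs \<and> ?xs ! l = v) \<longleftrightarrow> (\<exists>l. i < l \<and> l < ?m \<and> shuffle d l = v)" for v
    by auto
  have le: "layered_entry (shuffle d ` {..<?p}) ?xs i k =
    (if i < ?p
     then (if k = shuffle d i then T ^ card {l. i < l \<and> l < ?m \<and> shuffle d l < k}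
           else if k < shuffle d i \<and> (\<exists>l. i < l \<and> l < ?m \<and> shuffle d l = k)
           then (1 - T) * T ^ card {l. i < l \<and> l < ?m \<and> shuffle d l < k} else 0)
     else (if k = shuffle d i then 1 else 0))"
    unfolding layered_entry_def ex xi mem ll ..
  show ?thesis
  proof (cases "i < ?p")
    case True
    have dq: "d ! i \<le> last d" using sorted_le_last[OF sd(1) True] .
    have over_mono: "shuffle d i < shuffle d l" if "i < l" "l < ?p" for l
      using that sorted_nth_mono[OF sd(1), of i l] by (simp add: shuffle_over)
    have under: "shuffle d (?p + j) < shuffle d i \<longleftrightarrow> j < d ! i" for j
      using shuffle_over_less_under_iff(2)[OF sd(1) True] .
    have later_iff: "i < l \<and> l < ?m \<and> shuffle d l < v \<longleftrightarrow> ?p \<le> l \<and> l < ?m \<and> shuffle d l < v"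
      if "v \<le> shuffle d i" for l v
      using True over_mono[of l] that by (cases "l < ?p") auto
    have under_less: "shuffle d (?p + j) < shuffle d (?p + j') \<longleftrightarrow> j < j'" for j j'
      using overshoot_mono[of j j' d] overshoot_mono[of j' j d]
      by (cases "j < j'") (simp_all add: shuffle_under not_less add_mono)
    have card_own: "card {l. i < l \<and> l < ?m \<and> shuffle d l < shuffle d i} = d ! i"
    proof -
      have "{l. i < l \<and> l < ?m \<and> shuffle d l < shuffle d i} = {?p..<?p + d ! i}"
        unfolding later_iff[OF order_refl]
      proof (rule equalityI; rule subsetI)
        fix l assume "l \<in> {l. ?p \<le> l \<and> l < ?m \<and> shuffle d l < shuffle d i}"
        then show "l \<in> {?p..<?p + d ! i}" using under[of "l - ?p"] by auto
      next
        fix l assume "l \<in> {?p..<?p + d ! i}"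
        then show "l \<in> {l. ?p \<le> l \<and> l < ?m \<and> shuffle d l < shuffle d i}"
          using under[of "l - ?p"] dq by (auto simp: strands_def)
      qed
      then show ?thesis by simp
    qed
    have card_under: "card {l. i < l \<and> l < ?m \<and> shuffle d l < shuffle d (?p + j)} = j" if j: "j < d ! i" for j
    proof -
      have "{l. i < l \<and> l < ?m \<and> shuffle d l < shuffle d (?p + j)} = {?p..<?p + j}"
        unfolding later_iff[OF less_imp_le[OF under[THEN iffD2, OF j]]]
      proof (rule equalityI; rule subsetI)
        fix l assume "l \<in> {l. ?p \<le> l \<and> l < ?m \<and> shuffle d l < shuffle d (?p + j)}"
        then show "l \<in> {?p..<?p + j}" using under_less[of "l - ?p" j] by auto
      next
        fix l assume "l \<in> {?p..<?p + j}"
        then show "l \<in> {l. ?p \<le> l \<and> l < ?m \<and> shuffle d l < shuffle d (?p + j)}"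
          using under_less[of "l - ?p" j] dq j by (auto simp: strands_def)
      qed
      then show ?thesis by simp
    qed
    obtain b where b: "b < ?m" "k = shuffle d b"
      using shuffle_bij[OF sd(2,1)] k unfolding bij_betw_def by (metis image_iff lessThan_iff)
    consider "b = i" | "b < ?p" "b \<noteq> i" | j where "b = ?p + j" "j < last d"
      using b(1) unfolding strands_def by (metis add_diff_inverse_nat nat_add_left_cancel_less)
    then show ?thesis
    proof cases
      case 1
      have "(\<Sum>j<d ! i. if k = shuffle d (?p + j) then (1 - T) * T ^ j else 0) = 0"
        using True 1 b by (intro sum.neutral) (auto simp: inj)
      then show ?thesis unfolding le burau_entry_def using True 1 b card_own by simp
    next
      case 2
      have "(\<Sum>j<d ! i. if k = shuffle d (?p + j) then (1 - T) * T ^ j else 0) = 0"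
        using 2 b by (intro sum.neutral) (auto simp: inj)
      moreover have "\<not> (k < shuffle d i \<and> (\<exists>l. i < l \<and> l < ?m \<and> shuffle d l = k))"
      proof
        assume *: "k < shuffle d i \<and> (\<exists>l. i < l \<and> l < ?m \<and> shuffle d l = k)"
        then have "i < b" using b(2) by (auto simp: inj)
        then show False using over_mono[of b] 2 b(2) * by simp
      qed
      moreover have "k \<noteq> shuffle d i" using 2 b by (simp add: inj)
      ultimately show ?thesis unfolding le burau_entry_def using True by (simp only: if_True if_False add_0)
    next
      case 3
      have ki: "k \<noteq> shuffle d i" using 3 b True by (simp add: inj)
      have exl: "\<exists>l. i < l \<and> l < ?m \<and> shuffle d l = k" using 3 b True by (intro exI[of _ b]) auto
      have "(\<Sum>j'<d ! i. if k = shuffle d (?p + j') then (1 - T) * T ^ j' else 0) =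
          (\<Sum>j'<d ! i. if j' = j then (1 - T) * T ^ j else 0)"
        using 3 b by (intro sum.cong) (auto simp: inj)
      also have "\<dots> = (if j < d ! i then (1 - T) * T ^ j else 0)" by simp
      finally have s: "(\<Sum>j'<d ! i. if k = shuffle d (?p + j') then (1 - T) * T ^ j' else 0) =
          (if j < d ! i then (1 - T) * T ^ j else 0)" .
      have kj: "k < shuffle d i \<longleftrightarrow> j < d ! i" using under[of j] 3 b by simp
      show ?thesis
      proof (cases "j < d ! i")
        case j: True
        have "card {l. i < l \<and> l < ?m \<and> shuffle d l < k} = j" using card_under[OF j] 3 b by simp
        then show ?thesis unfolding le burau_entry_def s kj using True ki exl j
          by (simp only: if_True if_False add_0 simp_thms)
      next
        case False
        then show ?thesis unfolding le burau_entry_def s kj using True ki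
          by (simp only: if_True if_False add_0 simp_thms)
      qed
    qed
  next
    case False
    then show ?thesis unfolding le by (simp add: burau_entry_def)
  qed
qed

lemma alexander_raw_shuffle:
  assumes d: "shape d" and m: "m = strands d"
  shows "alexander_raw m (bubble_word (m * m) (map (shuffle d) [0..<m])) = alex T d"
proof -
  let ?xs = "map (shuffle d) [0..<m]"
  have sd: "sorted d" "d \<noteq> []" using d by (auto simp: shape_def)
  have "burau m (bubble_word (m * m) ?xs) =
      mat m m (\<lambda>(i, k). layered_entry (shuffle d ` {..<length d}) ?xs i k)"
  proof (rule burau_bubble_word)
    show "layered (shuffle d ` {..<length d}) ?xs" unfolding m by (rule layered_shuffle[OF d])
    show "distinct ?xs"
      by (simp add: distinct_map inj_on_subset[OF shuffle_inj[OF sd(1)] subset_UNIV])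
    show "set ?xs = {..<m}"
      using shuffle_bij[OF sd(2,1)] by (simp add: m bij_betw_def atLeast0LessThan)
    show "mass (shuffle d ` {..<length d}) ?xs \<le> m * m"
      using mass_le[of _ ?xs] by simp
  qed
  then have "1\<^sub>m m - burau m (bubble_word (m * m) ?xs) = alex_mat T d"
    using layered_entry_shuffle[OF d] unfolding m
    by (intro eq_matI) (auto simp: alex_mat_def)
  then show ?thesis by (simp add: alexander_raw_def alex_def cofactor_def)
qed

section \<open>Modular words\<close>

lemma bij_value_card:
  fixes \<pi> :: "nat \<Rightarrow> nat"
  assumes bij: "bij_betw \<pi> {..<m} {..<m}" and a: "a < m"
  shows "\<pi> a = card {b. b < m \<and> \<pi> b < \<pi> a}"
proof -
  have "\<pi> a < m" using bij a by (auto simp: bij_betw_def)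
  have "\<pi> ` {b. b < m \<and> \<pi> b < \<pi> a} = {..<\<pi> a}"
  proof (rule equalityI; rule subsetI)
    fix v assume "v \<in> {..<\<pi> a}"
    then have "v < m" "v < \<pi> a" using \<open>\<pi> a < m\<close> by auto
    moreover obtain b where "b < m" "\<pi> b = v"
      using bij \<open>v < m\<close> unfolding bij_betw_def by (metis image_iff lessThan_iff)
    ultimately show "v \<in> \<pi> ` {b. b < m \<and> \<pi> b < \<pi> a}" by blast
  qed blast
  moreover have "inj_on \<pi> {b. b < m \<and> \<pi> b < \<pi> a}"
    using bij unfolding bij_betw_def by (auto intro: inj_on_subset)
  ultimately show ?thesis using card_image[of \<pi> "{b. b < m \<and> \<pi> b < \<pi> a}"] by simp
qed

text \<open>A value of the permutation is the number of smaller values; counting these among over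
  and under strands separately gives the formulas of \<open>shuffle\<close>, with \<open>r a\<close>
  the number of under strands crossed by \<open>a\<close>. Absence of fixed points makes
  \<open>r a\<close> positive and provides strands of both kinds.\<close>

lemma shuffle_of_bij:
  fixes \<pi> :: "nat \<Rightarrow> nat"
  assumes bij: "bij_betw \<pi> {..<m} {..<m}" and p: "p \<le> m" and m: "0 < m"
    and over: "\<And>a b. a < b \<Longrightarrow> b < p \<Longrightarrow> \<pi> a < \<pi> b"
    and under: "\<And>a b. p \<le> a \<Longrightarrow> a < b \<Longrightarrow> b < m \<Longrightarrow> \<pi> a < \<pi> b"
    and nofix: "\<And>a. a < m \<Longrightarrow> \<pi> a \<noteq> a"
  obtains d where "shape d" "strands d = m" "\<And>i. i < m \<Longrightarrow> \<pi> i = shuffle d i"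
proof -
  define r where "r a = card {b. p \<le> b \<and> b < m \<and> \<pi> b < \<pi> a}" for a
  define l where "l a = card {b. b < p \<and> \<pi> b < \<pi> a}" for a
  define d where "d = map r [0..<p]"
  have inj: "\<pi> a = \<pi> b \<longleftrightarrow> a = b" if "a < m" "b < m" for a b
    using bij that by (auto simp: bij_betw_def inj_on_eq_iff)
  have over_iff: "\<pi> b < \<pi> a \<longleftrightarrow> b < a" if "a < p" "b < p" for a b
    using over[of a b] over[of b a] that by (cases a b rule: linorder_cases) auto
  have under_iff: "\<pi> b < \<pi> a \<longleftrightarrow> b < a" if "p \<le> a" "p \<le> b" "a < m" "b < m" for a b
    using under[of a b] under[of b a] that by (cases a b rule: linorder_cases) auto
  have split: "\<pi> a = l a + r a" if "a < m" for a
  proof -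
    have "{b. b < m \<and> \<pi> b < \<pi> a} = {b. b < p \<and> \<pi> b < \<pi> a} \<union> {b. p \<le> b \<and> b < m \<and> \<pi> b < \<pi> a}"
      using p by auto
    moreover have "card ({b. b < p \<and> \<pi> b < \<pi> a} \<union> {b. p \<le> b \<and> b < m \<and> \<pi> b < \<pi> a}) = l a + r a"
      unfolding l_def r_def by (rule card_Un_disjoint) auto
    ultimately show ?thesis using bij_value_card[OF bij that] by simp
  qed
  have \<pi>_over: "\<pi> a = a + r a" if "a < p" for a
  proof -
    have "b < p \<and> \<pi> b < \<pi> a \<longleftrightarrow> b < a" for b
      using over_iff[OF that, of b] that less_trans[of b a p] by blast
    then have "{b. b < p \<and> \<pi> b < \<pi> a} = {..<a}" unfolding lessThan_def by simp
    then have "l a = a" by (simp add: l_def)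
    then show ?thesis using split[of a] that p by simp
  qed
  have \<pi>_under: "\<pi> (p + j) = l (p + j) + j" if "p + j < m" for j
  proof -
    have "{b. p \<le> b \<and> b < m \<and> \<pi> b < \<pi> (p + j)} = {p..<p + j}"
      using under_iff[of "p + j"] that by auto
    then have "r (p + j) = j" by (simp add: r_def)
    then show ?thesis using split[OF that] by simp
  qed
  have r_pos: "1 \<le> r a" if "a < p" for a
    using \<pi>_over[OF that] nofix[of a] that p by (cases "r a") auto
  have r_mono: "r a \<le> r b" if "a \<le> b" "b < p" for a b
    unfolding r_def
  proof (rule card_mono)
    have "\<pi> a \<le> \<pi> b" using over[of a b] that by (cases "a = b") auto
    then show "{x. p \<le> x \<and> x < m \<and> \<pi> x < \<pi> a} \<subseteq> {x. p \<le> x \<and> x < m \<and> \<pi> x < \<pi> b}" by auto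
  qed simp
  have r_iff: "\<pi> a < \<pi> (p + j) \<longleftrightarrow> r a \<le> j" if "a < p" "p + j < m" for a j
  proof
    assume *: "\<pi> a < \<pi> (p + j)"
    have "{b. p \<le> b \<and> b < m \<and> \<pi> b < \<pi> a} \<subseteq> {p..<p + j}"
      using * under_iff[of "p + j"] that by (auto dest: less_trans)
    then show "r a \<le> j" unfolding r_def using card_mono[of "{p..<p + j}"] by fastforce
  next
    assume *: "r a \<le> j"
    show "\<pi> a < \<pi> (p + j)"
    proof (rule ccontr)
      assume "\<not> \<pi> a < \<pi> (p + j)"
      then have lt: "\<pi> (p + j) < \<pi> a" using inj[of a "p + j"] that by linarith
      have "{p..p + j} \<subseteq> {b. p \<le> b \<and> b < m \<and> \<pi> b < \<pi> a}"
      proof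
        fix b assume b: "b \<in> {p..p + j}"
        then have "\<pi> b \<le> \<pi> (p + j)" using under[of b "p + j"] that by (cases "b = p + j") auto
        then show "b \<in> {b. p \<le> b \<and> b < m \<and> \<pi> b < \<pi> a}" using b lt that by auto
      qed
      then have "card {p..p + j} \<le> r a" unfolding r_def by (intro card_mono) auto
      then show False using * by simp
    qed
  qed
  have p0: "0 < p"
  proof (rule ccontr)
    assume "\<not> 0 < p"
    then have "p = 0" "l 0 = 0" by (simp_all add: l_def)
    then show False using \<pi>_under[of 0] nofix[of 0] m by simp
  qed
  have pm: "p < m"
  proof (rule ccontr)
    assume "\<not> p < m"
    then have "r 0 = 0" unfolding r_def by (simp add: not_less)
    then show False using r_pos[OF p0] by simp
  qed
  have len: "length d = p" and nth: "\<And>i. i < p \<Longrightarrow> d ! i = r i" by (simp_all add: d_def)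
  have sd: "sorted d" unfolding sorted_iff_nth_mono using r_mono by (simp add: len nth)
  have d0: "d \<noteq> []" using p0 len by auto
  have d1: "\<forall>x\<in>set d. 1 \<le> x" unfolding d_def using r_pos by auto
  have last: "last d = m - p"
  proof -
    \<comment> \<open>If the last over strand missed the last under strand, the latter would lie to
      the right of everything and be fixed.\<close>
    have "\<not> \<pi> (p - 1) < \<pi> (p + (m - p - 1))"
    proof
      assume *: "\<pi> (p - 1) < \<pi> (p + (m - p - 1))"
      have "\<pi> b < \<pi> (p + (m - p - 1))" if "b < p" for b
      proof (cases "b = p - 1")
        case False
        then have "\<pi> b < \<pi> (p - 1)" using that by (intro over) simp_all
        then show ?thesis using * by (rule less_trans)
      qed (use * in simp)
      then have "{b. b < p \<and> \<pi> b < \<pi> (p + (m - p - 1))} = {..<p}" by auto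
      then have "l (p + (m - p - 1)) = p" by (simp add: l_def)
      then have "\<pi> (m - 1) = m - 1" using \<pi>_under[of "m - p - 1"] pm by simp
      then show False using nofix[of "m - 1"] m by simp
    qed
    then have "m - p - 1 < r (p - 1)" using r_iff[of "p - 1" "m - p - 1"] p0 pm by simp
    moreover have "r (p - 1) \<le> m - p"
    proof -
      have "{b. p \<le> b \<and> b < m \<and> \<pi> b < \<pi> (p - 1)} \<subseteq> {p..<m}" by auto
      then have "r (p - 1) \<le> card {p..<m}" unfolding r_def by (rule card_mono[rotated]) simp
      then show ?thesis by simp
    qed
    moreover have "last d = r (p - 1)" using d0 p0 by (simp add: last_conv_nth len nth)
    ultimately show ?thesis by linarith
  qed
  show thesis
  proof (rule that)
    show "shape d" using sd d0 d1 by (simp add: shape_def)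
    show "strands d = m" using last pm by (simp add: strands_def len)
    fix i assume i: "i < m"
    show "\<pi> i = shuffle d i"
    proof (cases "i < p")
      case True
      then show ?thesis by (simp add: shuffle_over len nth \<pi>_over)
    next
      case False
      define j where "j = i - p"
      have ij: "i = p + j" using False by (simp add: j_def)
      have "overshoot d j = l i"
        unfolding overshoot_def l_def len
        by (rule arg_cong[where f = card]) (use r_iff[of _ j] i ij nth in auto)
      then show ?thesis using \<pi>_under[of j] i shuffle_under[of d j] by (simp add: ij len)
    qed
  qed
qed

section \<open>Lexicographic order, primitivity and ranks\<close>

lemma lex_less_irrefl: "\<not> lex_less u u"
  unfolding lex_less_def by (rule lexord_irreflexive) simp

lemma lex_less_trans: "lex_less u v \<Longrightarrow> lex_less v w \<Longrightarrow> lex_less u w"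
  unfolding lex_less_def by (rule lexord_trans) (auto simp: trans_def)

lemma lex_less_linear: "lex_less u v \<or> u = v \<or> lex_less v u"
  unfolding lex_less_def
  by (rule lexord_linear) (metis (full_types) letter.exhaust insertI1)

lemma lex_less_Cons: "lex_less (x # u) (y # v) \<longleftrightarrow> x = L \<and> y = R \<or> x = y \<and> lex_less u v"
  unfolding lex_less_def by auto

text \<open>Words of equal length are compared at a common position, so the suffixes are never
  reached; a proper prefix would behave differently.\<close>

lemma lex_less_append:
  "lex_less u v \<Longrightarrow> length u = length v \<Longrightarrow> lex_less (u @ x) (v @ y)"
  by (induction u v rule: list_induct2') (auto simp: lex_less_Cons lex_less_irrefl)

text \<open>If two rotations agree, some proper prefix of \<open>W\<close> commutes with the
  remaining suffix. Commuting words are powers of a common word, and then so is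
  \<open>W\<close>.\<close>

lemma rotate_inj_if_primitive:
  assumes W: "primitive_word W" and ij: "i < length W" "j < length W" "rotate i W = rotate j W"
  shows "i = j"
proof -
  have no: "\<not> i < j" if ij: "i < length W" "j < length W" "rotate i W = rotate j W" for i j
  proof
    assume "i < j"
    define r where "r = j - i"
    define s where "s = length W - i"
    have r: "0 < r" "r < length W" using ij \<open>i < j\<close> by (auto simp: r_def)
    have "rotate r W = rotate r (rotate (s + i) W)" using ij by (simp add: s_def)
    also have "\<dots> = rotate s (rotate j W)"
      using \<open>i < j\<close> by (simp add: rotate_rotate r_def add.commute add.left_commute)
    also have "\<dots> = rotate s (rotate i W)" using ij by simp
    also have "\<dots> = W" using ij(1) by (simp add: rotate_rotate s_def)
    finally have "drop r W @ take r W = take r W @ drop r W"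
      using r by (simp add: rotate_drop_take)
    then obtain a b zs where ab: "concat (replicate a zs) = drop r W" "concat (replicate b zs) = take r W"
      using comm_append_are_replicate by blast
    have "a \<noteq> 0" "b \<noteq> 0" using ab r by (auto intro!: Nat.gr0I)
    then have "2 \<le> b + a" by simp
    moreover have "W = concat (replicate (b + a) zs)"
      using ab by (simp add: replicate_add)
    ultimately show False using W unfolding primitive_word_def by blast
  qed
  show ?thesis using no[of i j] no[of j i] ij by (metis linorder_neqE_nat)
qed

context
  fixes W :: "letter list"
  assumes W: "primitive_word W"
begin

lemma rk_less_iff:
  assumes "i < length W" "j < length W"
  shows "rk W i < rk W j \<longleftrightarrow> lex_less (rotate i W) (rotate j W)"
proof -
  have less: "rk W i < rk W j" if "i < length W" "lex_less (rotate i W) (rotate j W)" for i j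
    unfolding rk_def
  proof (rule psubset_card_mono)
    show "{k. k < length W \<and> lex_less (rotate k W) (rotate i W)} \<subset>
          {k. k < length W \<and> lex_less (rotate k W) (rotate j W)}"
      using that lex_less_trans lex_less_irrefl by blast
  qed simp
  show ?thesis
    using less[OF assms(1)] less[OF assms(2), of i] lex_less_linear[of "rotate i W" "rotate j W"]
      rotate_inj_if_primitive[OF W assms] by (metis less_asym less_irrefl)
qed

lemma rk_bij: "bij_betw (rk W) {..<length W} {..<length W}"
proof -
  have "inj_on (rk W) {..<length W}"
  proof (rule inj_onI)
    fix i j assume ij: "i \<in> {..<length W}" "j \<in> {..<length W}" "rk W i = rk W j"
    then have "\<not> lex_less (rotate i W) (rotate j W)" "\<not> lex_less (rotate j W) (rotate i W)"
      using rk_less_iff[of i j] rk_less_iff[of j i] by auto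
    then show "i = j"
      using lex_less_linear[of "rotate i W" "rotate j W"] rotate_inj_if_primitive[OF W, of i j] ij by auto
  qed
  moreover have "rk W k < length W" if "k < length W" for k
  proof -
    have "{i. i < length W \<and> lex_less (rotate i W) (rotate k W)} \<subset> {..<length W}"
      using that lex_less_irrefl by blast
    then have "rk W k < card {..<length W}" unfolding rk_def by (rule psubset_card_mono[rotated]) simp
    then show ?thesis by simp
  qed
  ultimately show ?thesis by (simp add: bij_betw_def endo_inj_surj image_subset_iff)
qed

lemma modular_perm_rk:
  assumes "k < length W"
  shows "modular_perm W ! rk W k = rk W (Suc k mod length W)"
proof -
  have "rk W k < length W" using rk_bij assms by (auto simp: bij_betw_def)
  moreover have "(THE k'. k' < length W \<and> rk W k' = rk W k) = k"
    using rk_bij assms by (intro the_equality) (auto simp: bij_betw_def inj_on_def)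
  ultimately show ?thesis by (simp add: modular_perm_def)
qed

lemma rotate_Cons_nth:
  assumes "k < length W"
  shows "rotate k W = W ! k # drop (Suc k) W @ take k W"
    and "rotate (Suc k mod length W) W = (drop (Suc k) W @ take k W) @ [W ! k]"
proof -
  show "rotate k W = W ! k # drop (Suc k) W @ take k W"
    using assms by (simp add: rotate_drop_take Cons_nth_drop_Suc[symmetric])
  then have "rotate1 (rotate k W) = (drop (Suc k) W @ take k W) @ [W ! k]" by simp
  then show "rotate (Suc k mod length W) W = (drop (Suc k) W @ take k W) @ [W ! k]"
    by (simp add: rotate_conv_mod[symmetric])
qed

text \<open>Rotations beginning with the smaller letter \<open>L\<close> take the lowest ranks, so
  the over strands occupy the first top points.\<close>

lemma rk_less_number_of_Ls_iff:
  assumes "k < length W"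
  shows "rk W k < card {i. i < length W \<and> W ! i = L} \<longleftrightarrow> W ! k = L"
proof (cases "W ! k")
  case L
  have "{i. i < length W \<and> lex_less (rotate i W) (rotate k W)} \<subset> {i. i < length W \<and> W ! i = L}"
  proof
    show "{i. i < length W \<and> lex_less (rotate i W) (rotate k W)} \<subseteq> {i. i < length W \<and> W ! i = L}"
      using L assms by (auto simp: rotate_Cons_nth(1) lex_less_Cons)
    show "{i. i < length W \<and> lex_less (rotate i W) (rotate k W)} \<noteq> {i. i < length W \<and> W ! i = L}"
      using L assms lex_less_irrefl by blast
  qed
  then have "rk W k < card {i. i < length W \<and> W ! i = L}"
    unfolding rk_def by (rule psubset_card_mono[rotated]) simp
  with L show ?thesis by simp
next
  case R
  have "{i. i < length W \<and> W ! i = L} \<subseteq> {i. i < length W \<and> lex_less (rotate i W) (rotate k W)}"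
    using R assms by (auto simp: rotate_Cons_nth(1) lex_less_Cons)
  then have "card {i. i < length W \<and> W ! i = L} \<le> rk W k"
    unfolding rk_def by (rule card_mono[rotated]) simp
  with R show ?thesis by simp
qed

text \<open>Strands of the same kind do not cross: removing a common first letter preserves a strict
  inequality, and the letter appended at the end comes too late to matter.\<close>

lemma rk_Suc_less:
  assumes k: "k < length W" "l < length W" "W ! k = W ! l" "rk W k < rk W l"
  shows "rk W (Suc k mod length W) < rk W (Suc l mod length W)"
proof -
  have m: "Suc k mod length W < length W" "Suc l mod length W < length W"
    using k(1) by (auto intro: mod_less_divisor)
  have "lex_less (rotate k W) (rotate l W)" using rk_less_iff k by simp
  then have "lex_less (drop (Suc k) W @ take k W) (drop (Suc l) W @ take l W)"
    using k by (auto simp: rotate_Cons_nth(1) lex_less_Cons)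
  then have "lex_less ((drop (Suc k) W @ take k W) @ [W ! k]) ((drop (Suc l) W @ take l W) @ [W ! l])"
    by (rule lex_less_append) (use k in simp)
  then show ?thesis unfolding rk_less_iff[OF m] using k by (simp only: rotate_Cons_nth(2))
qed

text \<open>In the coordinate \<open>k\<close> of \<open>rk W k\<close> the permutation is the shift
  from \<open>k\<close> to \<open>Suc k mod length W\<close>; bijectivity and, for length at least
  2, the absence of fixed points follow from this.\<close>

lemma modular_perm_shuffle:
  assumes len: "2 \<le> length W"
  obtains d where "shape d" "strands d = length W" "modular_perm W = map (shuffle d) [0..<length W]"
proof -
  let ?m = "length W" and ?p = "card {i. i < length W \<and> W ! i = L}"
  define \<pi> where "\<pi> a = modular_perm W ! a" for a
  have \<pi>: "\<pi> (rk W k) = rk W (Suc k mod ?m)" if "k < ?m" for k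
    using modular_perm_rk[OF that] by (simp add: \<pi>_def)
  have ex: "\<exists>k<?m. a = rk W k" if "a < ?m" for a
    using rk_bij that unfolding bij_betw_def by (metis image_iff lessThan_iff)
  have inj: "rk W k = rk W l \<longleftrightarrow> k = l" if "k < ?m" "l < ?m" for k l
    using rk_bij that by (auto simp: bij_betw_def inj_on_eq_iff)
  have mono: "\<pi> a < \<pi> b" if "a < b" "b < ?m" "a < ?p \<longleftrightarrow> b < ?p" for a b
  proof -
    have "a < ?m" "b < ?m" using that(1,2) by auto
    then obtain k where k: "k < ?m" "a = rk W k" using ex \<open>a < ?m\<close> by blast
    obtain l where l: "l < ?m" "b = rk W l" using ex \<open>b < ?m\<close> by blast
    have "W ! k = L \<longleftrightarrow> W ! l = L" using that(3) rk_less_number_of_Ls_iff k l by simp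
    then have "W ! k = W ! l" by (metis letter.exhaust)
    then show ?thesis using rk_Suc_less[OF k(1) l(1)] that(1) k l \<pi> by simp
  qed
  have mod_eq: "k = l" if "k < ?m" "l < ?m" "Suc k mod ?m = Suc l mod ?m" for k l
    using that by (auto simp: mod_Suc split: if_splits)
  have lt: "Suc k mod ?m < ?m" for k using len by (intro mod_less_divisor) linarith
  have p: "?p \<le> ?m"
    using card_mono[of "{..<?m}" "{i. i < ?m \<and> W ! i = L}"] by auto
  have bij: "bij_betw \<pi> {..<?m} {..<?m}"
  proof -
    have "inj_on \<pi> {..<?m}"
    proof (rule inj_onI)
      fix a b assume ab: "a \<in> {..<?m}" "b \<in> {..<?m}" "\<pi> a = \<pi> b"
      obtain k where k: "k < ?m" "a = rk W k" using ex[of a] ab by auto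
      obtain l where l: "l < ?m" "b = rk W l" using ex[of b] ab by auto
      have "Suc k mod ?m = Suc l mod ?m" using ab(3) k l \<pi> inj[OF lt lt] by simp
      then show "a = b" using mod_eq[OF k(1) l(1)] k l by simp
    qed
    moreover have "\<pi> a < ?m" if a: "a < ?m" for a
    proof -
      obtain k where k: "k < ?m" "a = rk W k" using ex[OF a] by auto
      then show ?thesis using \<pi> rk_bij lt[of k] by (auto simp: bij_betw_def)
    qed
    ultimately show ?thesis by (simp add: bij_betw_def endo_inj_surj image_subset_iff)
  qed
  have nofix: "\<pi> a \<noteq> a" if a: "a < ?m" for a
  proof
    assume *: "\<pi> a = a"
    obtain k where k: "k < ?m" "a = rk W k" using ex[OF a] by auto
    then have "Suc k mod ?m = k" using * \<pi> inj[OF lt k(1)] by simp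
    then show False using k(1) len by (auto simp: mod_Suc split: if_splits)
  qed
  obtain d where d: "shape d" "strands d = ?m" "\<And>i. i < ?m \<Longrightarrow> \<pi> i = shuffle d i"
  proof (rule shuffle_of_bij[OF bij p])
    show "0 < ?m" using len by linarith
    show "\<pi> a < \<pi> b" if "a < b" "b < ?p" for a b using mono[of a b] that p by simp
    show "\<pi> a < \<pi> b" if "?p \<le> a" "a < b" "b < ?m" for a b using mono[of a b] that by simp
  qed (use nofix in blast)+
  moreover have "modular_perm W = map (shuffle d) [0..<?m]"
    using d(3) by (intro nth_equalityI) (simp_all add: \<pi>_def modular_perm_def)
  ultimately show thesis using that by blast
qed

lemma modular_alexander_eq_alex:
  assumes len: "2 \<le> length W"
  obtains d where "shape d" "modular_alexander W = alex T d"
proof -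
  obtain d where d: "shape d" "strands d = length W" "modular_perm W = map (shuffle d) [0..<length W]"
    using modular_perm_shuffle[OF len] .
  have "alexander_raw (length W) (modular_braid_word W) = alex T d"
    unfolding modular_braid_word_def d(3) using alexander_raw_shuffle[OF d(1)] d(2) by simp
  \<comment> \<open>\<open>rk W\<close> lists the top points in the order in which the closed braid
    visits them, which is the single cycle needed for the value at 1.\<close>
  moreover have "alex (1 :: int) d = 1"
  proof (rule alex_1[OF d(1)])
    show "bij_betw (rk W) {..<length W} {..<length W}" by (rule rk_bij)
    fix k assume k: "Suc k < length W"
    then have "rk W k < length W" using rk_bij by (auto simp: bij_betw_def)
    then show "shuffle d (rk W k) = rk W (Suc k)"
      using modular_perm_rk[of k] k d(3) by simp
  qed (simp add: d(2))
  ultimately have "modular_alexander W = alex T d"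
    using alex_0[OF d(1)] by (simp add: modular_alexander_def alex_normalize_id poly_alex)
  with d(1) that show thesis by blast
qed

end

theorem theorem7p1:
  fixes n :: nat
  assumes "n > 0" and "even n"
  shows "finite (A_set n) \<and> card (A_set n) \<le> partition_count n"
proof -
  let ?P = "{M :: nat multiset. (\<forall>x\<in>#M. x > 0) \<and> sum_mset M = n}"
  let ?F = "\<lambda>M. alex T (canonical_shape M)"
  have "A_set n \<subseteq> ?F ` ?P"
  proof
    fix f assume "f \<in> A_set n"
    then obtain W where W: "is_modular_word W" "f = modular_alexander W" "degree f = n"
      by (auto simp: A_set_def)
    then obtain d where d: "shape d" "f = alex T d"
      using modular_alexander_eq_alex[of W] by (auto simp: is_modular_word_def)
    have sum: "sum_mset (core d) = n"
      using degree_alex[OF d(1)] W(3) d(2) by (simp add: sum_mset_core)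
    \<comment> \<open>Positive degree guarantees a nonempty core, where
      \<open>canonical_shape\<close> is meaningful.\<close>
    then have "core d \<noteq> {#}" using assms(1) by auto
    then have "f = ?F (core d)"
      using alex_canonical_shape[OF d(1), of T] d(2) by simp
    moreover have "core d \<in> ?P" using sum by (auto simp: core_def)
    ultimately show "f \<in> ?F ` ?P" by blast
  qed
  then show ?thesis
    using finite_partitions[of n] unfolding partition_count_def
    by (meson surj_card_le finite_surj)
qed

end
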